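(* Let $\kappa_0:=\frac{1}{|\Omega|}\int_\Omega\kappa$. If $\kappa-\kappa_0\in H^{-2}(\Omega;\mathbb{R})$, then there exists a solution $(\phi,\mu)\in H^2(\Omega;\mathbb{R})\times\mathbb{R}$ to the LSC (Landscape regularized semi-classical) equation $$-\Delta\phi=\kappa-F_{\rm LSC}(\phi,\mu).$$
   Context: Setting: $0<L\in\mathbb{Z}$ and $\Omega=\mathbb{R}^3/(L\mathbb{Z})^3\cong[0,L]^3$. Functions on $\Omega$ are identified with $(L\mathbb{Z})^3$-periodic functions on $\mathbb{R}^3$; $H^s(\Omega;\mathbb{R})$ are the real-valued Sobolev spaces of order $s$ with periodic boundary conditions. $\kappa$ is the periodic dopant density and $\kappa_0$ is its mean over $\Omega$. $\varepsilon>0$ is the semi-classical parameter and $\beta>0$ is the inverse temperature. $V$ is a Landscape admissible potential: strictly positive and piecewise constant, of the form $V(x)=\sum_{j\in\mathbb{Z}^3}\omega_j\chi(x-j)$, where $0<\omega_j\in\mathbb{R}$ is $(L\mathbb{Z})^3$-periodic in $j$ and $\chi$ is the indicator function of $[0,1)^3$. $V_{\min},V_{\max}$ denote its minimum and maximum, and $\delta=V_{\max}-V_{\min}>0$. $f_{\rm FD}(\lambda)=\frac{1}{1+e^\lambda}$ is the Fermi-Dirac function and $$F_{\rm LSC}(\phi,\mu)=\frac{1}{(2\pi\varepsilon)^3}\int_{\mathbb{R}^3}dp\,f_{\rm FD}(\beta(p^2+W_2-\phi+V_{\rm cut}-\mu)),$$ where $W_2=1/u_2$ and $u_2$ is the periodic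 solution of $(-\varepsilon^2\Delta+V-V_{\rm cut})u_2=1$. Here $V_{\rm cut}\in\mathbb{R}$ is a fixed constant with $c\,\delta^{1/4}\le V_{\min}-V_{\rm cut}\le C\delta^{1/4}$, where $c,C>0$ are constants independent of $\varepsilon,\delta,\beta,V,\kappa$ (in particular $V_{\rm cut}<V_{\min}$).
   Formalization: Two hypotheses are added, each necessary for a solution with φ in H²: κ is square integrable on Ω (not merely κ−κ₀ in H^{-2}), since φ in H² makes F_LSC bounded and forces κ in L²; and κ₀ > 0, since integrating the equation gives |Ω|κ₀ = ∫F_LSC > 0. *)

theory Defs
  imports "HOL-Analysis.Analysis"
begin

definition int_vec :: "int^3 \<Rightarrow> real^3" where
  "int_vec k = (\<chi> i. of_int (k $ i))"

text \<open>Functions on the torus are \<open>(L \<int>)\<^sup>3\<close>-periodic functions on \<open>\<real>\<^sup>3\<close>;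
  integrals over the torus are taken over the cell \<open>[0,L]\<^sup>3\<close>.\<close>

definition torus_cell :: "int \<Rightarrow> (real^3) set" where
  "torus_cell L = cbox 0 (\<chi> i. of_int L)"

definition periodic :: "int \<Rightarrow> (real^3 \<Rightarrow> real) \<Rightarrow> bool" where
  "periodic L f \<longleftrightarrow> (\<forall>x m. f (x + of_int L *\<^sub>R int_vec m) = f x)"

definition L1_per :: "int \<Rightarrow> (real^3 \<Rightarrow> real) \<Rightarrow> bool" where
  "L1_per L f \<longleftrightarrow> periodic L f \<and> set_integrable lborel (torus_cell L) f"

definition L2_per :: "int \<Rightarrow> (real^3 \<Rightarrow> real) \<Rightarrow> bool" where
  "L2_per L f \<longleftrightarrow> L1_per L f \<and> set_integrable lborel (torus_cell L) (\<lambda>x. (f x)\<^sup>2)"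

definition mean :: "int \<Rightarrow> (real^3 \<Rightarrow> real) \<Rightarrow> real" where
  "mean L f = (LINT x:torus_cell L|lborel. f x) / measure lborel (torus_cell L)"

definition frequency :: "int \<Rightarrow> int^3 \<Rightarrow> real^3" where
  "frequency L k = (2 * pi / of_int L) *\<^sub>R int_vec k"

definition fourier_coeff :: "int \<Rightarrow> (real^3 \<Rightarrow> real) \<Rightarrow> int^3 \<Rightarrow> complex" where
  "fourier_coeff L f k =
     (LINT x:torus_cell L|lborel. cis (- (frequency L k \<bullet> x)) * of_real (f x)) /
     of_real (measure lborel (torus_cell L))"

text \<open>Real-valued periodic Sobolev space of order \<open>s\<close>. For \<open>s \<ge> 0\<close> this is all of
  \<open>H\<^sup>s\<close> (up to null sets); for \<open>s < 0\<close> it consists of the elements of \<open>H\<^sup>s\<close> that are represented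
  by an integrable function.\<close>

definition in_sobolev :: "int \<Rightarrow> real \<Rightarrow> (real^3 \<Rightarrow> real) \<Rightarrow> bool" where
  "in_sobolev L s f \<longleftrightarrow> L1_per L f \<and>
     (\<lambda>k. (1 + (norm (frequency L k))\<^sup>2) powr s * (cmod (fourier_coeff L f k))\<^sup>2)
       summable_on UNIV"

definition partial_deriv :: "3 \<Rightarrow> (real^3 \<Rightarrow> real) \<Rightarrow> real^3 \<Rightarrow> real" where
  "partial_deriv i f x = deriv (\<lambda>t. f (x + t *\<^sub>R axis i 1)) 0"

fun Ck :: "nat \<Rightarrow> (real^3 \<Rightarrow> real) \<Rightarrow> bool" where
  "Ck 0 f \<longleftrightarrow> continuous_on UNIV f"
| "Ck (Suc n) f \<longleftrightarrow> (\<forall>x. f differentiable (at x)) \<and> (\<forall>i. Ck n (partial_deriv i f))"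

definition test_function :: "int \<Rightarrow> (real^3 \<Rightarrow> real) \<Rightarrow> bool" where
  "test_function L \<psi> \<longleftrightarrow> periodic L \<psi> \<and> (\<forall>n. Ck n \<psi>)"

definition laplacian :: "(real^3 \<Rightarrow> real) \<Rightarrow> real^3 \<Rightarrow> real" where
  "laplacian \<psi> x = (\<Sum>i\<in>UNIV. partial_deriv i (partial_deriv i \<psi>) x)"

text \<open>\<open>g\<close> is the distributional Laplacian of \<open>f\<close> on the torus.\<close>

definition weak_laplacian :: "int \<Rightarrow> (real^3 \<Rightarrow> real) \<Rightarrow> (real^3 \<Rightarrow> real) \<Rightarrow> bool" where
  "weak_laplacian L f g \<longleftrightarrow> L1_per L f \<and> L1_per L g \<and>
     (\<forall>\<psi>. test_function L \<psi> \<longrightarrow>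
        (LINT x:torus_cell L|lborel. f x * laplacian \<psi> x) =
        (LINT x:torus_cell L|lborel. g x * \<psi> x))"

definition unit_cell :: "(real^3) set" where
  "unit_cell = {x. \<forall>i. 0 \<le> x $ i \<and> x $ i < 1}"

text \<open>At every point exactly one term of the sum is nonzero.\<close>

definition potential :: "(int^3 \<Rightarrow> real) \<Rightarrow> real^3 \<Rightarrow> real" where
  "potential \<omega> x = (\<Sum>\<^sub>\<infinity>j. \<omega> j * indicator unit_cell (x - int_vec j))"

definition landscape_admissible :: "int \<Rightarrow> (int^3 \<Rightarrow> real) \<Rightarrow> bool" where
  "landscape_admissible L \<omega> \<longleftrightarrow>
     (\<forall>j. 0 < \<omega> j) \<and> (\<forall>j m. \<omega> (\<chi> i. j $ i + L * m $ i) = \<omega> j)"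

text \<open>For an admissible \<open>\<omega>\<close> the range of the potential is finite, so these are a minimum and a
  maximum.\<close>

definition Vmin :: "(int^3 \<Rightarrow> real) \<Rightarrow> real" where
  "Vmin \<omega> = (INF x. potential \<omega> x)"

definition Vmax :: "(int^3 \<Rightarrow> real) \<Rightarrow> real" where
  "Vmax \<omega> = (SUP x. potential \<omega> x)"

definition landscape_function ::
  "int \<Rightarrow> real \<Rightarrow> (real^3 \<Rightarrow> real) \<Rightarrow> real \<Rightarrow> (real^3 \<Rightarrow> real) \<Rightarrow> bool" where
  "landscape_function L \<epsilon> V Vcut u \<longleftrightarrow> in_sobolev L 2 u \<and>
     (\<exists>D. weak_laplacian L u D \<and>
        (AE x in lborel. - \<epsilon>\<^sup>2 * D x + (V x - Vcut) * u x = 1))"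

definition f_FD :: "real \<Rightarrow> real" where
  "f_FD t = 1 / (1 + exp t)"

definition F_LSC ::
  "real \<Rightarrow> real \<Rightarrow> real \<Rightarrow> (real^3 \<Rightarrow> real) \<Rightarrow> (real^3 \<Rightarrow> real) \<Rightarrow> real \<Rightarrow> real^3 \<Rightarrow> real" where
  "F_LSC \<epsilon> \<beta> Vcut u \<phi> \<mu> x =
     1 / (2 * pi * \<epsilon>) ^ 3 *
     (LINT p|(lborel :: (real^3) measure).
        f_FD (\<beta> * ((norm p)\<^sup>2 + 1 / u x - \<phi> x + Vcut - \<mu>)))"

definition LSC_solution ::
  "int \<Rightarrow> real \<Rightarrow> real \<Rightarrow> real \<Rightarrow> (real^3 \<Rightarrow> real) \<Rightarrow> (real^3 \<Rightarrow> real) \<Rightarrow>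
     (real^3 \<Rightarrow> real) \<Rightarrow> real \<Rightarrow> bool" where
  "LSC_solution L \<epsilon> \<beta> Vcut u \<kappa> \<phi> \<mu> \<longleftrightarrow>
     (\<exists>D. weak_laplacian L \<phi> D \<and>
        (AE x in lborel. - D x = \<kappa> x - F_LSC \<epsilon> \<beta> Vcut u \<phi> \<mu> x))"

end

theory Submission
  imports Defs "HOL-Probability.Probability"
begin

text \<open>
  \<^bold>\<open>Reduction.\<close>  The right-hand side at \<open>x\<close> is a function \<open>G\<close> of \<open>\<phi> x + \<mu> - 1 / u\<^sub>2 x - Vcut\<close> alone,
  where \<open>G\<close>, the Fermi-Dirac density, is increasing and continuous with infimum \<open>0\<close> and
  supremum \<open>\<infinity>\<close> (\<open>fermi_density_small\<close>, \<open>fermi_density_large\<close>).  A constant added to \<open>\<phi>\<close> has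
  the effect of \<open>\<mu>\<close>, so \<open>\<mu> = 0\<close> can be taken.  Write \<open>\<phi> = v + \<psi>\<close> with \<open>- \<Delta> \<psi> = \<kappa> - \<kappa>\<^sub>0\<close>.  Since \<open>\<kappa>\<close> is
  square integrable, \<open>\<psi>\<close> is bounded (\<open>Poisson_bounded\<close>), and there remains
  \<open>- \<Delta> v + G (v + b) = \<kappa>\<^sub>0\<close> with \<open>b = \<psi> - 1 / u\<^sub>2 - Vcut\<close>.

  \<^bold>\<open>Existence.\<close>  The landscape function is at least \<open>1 / (Vmax - Vcut)\<close> by a minimum principle
  (\<open>landscape_lower_bound\<close>), so \<open>1 / u\<^sub>2\<close> and hence \<open>b\<close> are bounded almost everywhere.  As \<open>\<kappa>\<^sub>0 > 0\<close> lies
  in the range of \<open>G\<close>, a very negative constant is then a subsolution and a large constant a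
  supersolution, and monotone iteration between them converges to a solution
  (\<open>monotone_iteration\<close>).  Its Laplacian is square integrable, which puts \<open>\<phi>\<close> into \<open>H\<^sup>2\<close>
  (\<open>weak_laplacian_sobolev\<close>).

  \<^bold>\<open>The resolvent.\<close>  Both the minimum principle and the iteration rest on the operator
  \<open>(lam - \<Delta>)\<^sup>-\<^sup>1\<close>, which preserves positivity and maps the constant \<open>1\<close> to \<open>1 / lam\<close>.  It is
  built as convolution with a probability measure on \<open>\<real>\<^sup>3\<close>, the law of Brownian motion stopped at an
  exponential time (\<open>resolvent_kernel_exists\<close>); positivity is then immediate, and its
  characteristic function gives the Fourier multiplier.

  \<^bold>\<open>Fourier analysis.\<close>  The link between the resolvent and the weak Laplacian is that
  \<open>weak_laplacian L f g\<close> holds for integrable periodic \<open>f\<close>, \<open>g\<close> exactly if the Fourier coefficients of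
  \<open>g\<close> are \<open>- (norm \<xi>)\<^sup>2\<close> times those of \<open>f\<close> (\<open>weak_laplacian_fourier\<close>,
  \<open>weak_laplacianI_fourier\<close>).  This uses that an integrable function is determined by its Fourier
  coefficients (\<open>fourier_unique\<close>), which follows from the Stone-Weierstrass theorem.
\<close>

section \<open>Integration over the torus\<close>

locale torus =
  fixes L :: int
  assumes L_pos: "0 < L"
begin

text \<open>Normalised to total mass \<open>1\<close>, so that means and Fourier coefficients are plain integrals.\<close>

definition tor :: "(real^3) measure" where
  "tor = uniform_measure lborel (torus_cell L)"

definition shift :: "int^3 \<Rightarrow> real^3" where
  "shift m = of_int L *\<^sub>R int_vec m"

text \<open>The same notion as \<^const>\<open>periodic\<close>, but also for complex and extended real functions.\<close>

definition per :: "(real^3 \<Rightarrow> 'a) \<Rightarrow> bool" where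
  "per f \<longleftrightarrow> (\<forall>x m. f (x + shift m) = f x)"

definition hcell :: "(real^3) set" where
  "hcell = {x. \<forall>i. 0 \<le> x $ i \<and> x $ i < of_int L}"

text \<open>The representative of a point in \<open>hcell\<close>; it turns a statement about a periodic function into
  one about its values on the cell.\<close>

definition red :: "real^3 \<Rightarrow> real^3" where
  "red x = x + shift (\<chi> i. - \<lfloor>x $ i / of_int L\<rfloor>)"

lemma periodic_iff_per: "periodic L f \<longleftrightarrow> per f"
  by (simp add: periodic_def per_def shift_def)

lemma per_shift: "per f \<Longrightarrow> f (x + shift m) = f x"
  by (simp add: per_def)

lemma shift_nth: "shift m $ i = of_int (L * m $ i)"
  by (simp add: shift_def int_vec_def)

lemma shift_uminus: "shift (- m) = - shift m"
  by (vector shift_def int_vec_def)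

lemma in_cell: "x \<in> torus_cell L \<longleftrightarrow> (\<forall>i. 0 \<le> x $ i \<and> x $ i \<le> of_int L)"
  by (auto simp: torus_cell_def mem_box_cart)

lemma hcell_subset: "hcell \<subseteq> torus_cell L"
  by (auto simp: hcell_def in_cell less_imp_le)

lemma borel_cell [measurable]: "torus_cell L \<in> sets borel"
  by (simp add: torus_cell_def)

lemma borel_hcell [measurable]: "hcell \<in> sets borel"
proof -
  have "hcell = (\<Inter>i. {x. 0 \<le> x $ i} \<inter> {x. x $ i < of_int L})"
    by (auto simp: hcell_def)
  also have "\<dots> \<in> sets borel"
    by (intro sets.countable_INT' sets.Int borel_closed borel_open closed_Collect_le open_Collect_less
        continuous_intros image_subsetI) auto
  finally show ?thesis .
qed

lemma emeasure_box_L: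
  "emeasure lborel (box 0 ((\<chi> i. of_int L) :: real^3)) = emeasure lborel (torus_cell L)"
  using L_pos by (simp add: torus_cell_def emeasure_lborel_cbox_eq emeasure_lborel_box_eq Basis_vec_def
      inner_axis)

lemma emeasure_cell: "emeasure lborel (torus_cell L) = ennreal (of_int L ^ 3)"
proof -
  have "emeasure lborel (torus_cell L) = ennreal (\<Prod>b\<in>(Basis :: (real^3) set). ((\<chi> i. of_int L) - 0) \<bullet> b)"
    unfolding torus_cell_def
    using L_pos by (intro emeasure_lborel_cbox) (auto simp: Basis_vec_def inner_axis)
  also have "(\<Prod>b\<in>(Basis :: (real^3) set). ((\<chi> i. of_int L) - 0) \<bullet> b) = (\<Prod>b\<in>(Basis :: (real^3) set). of_int L)"
    by (intro prod.cong) (auto simp: Basis_vec_def inner_axis)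
  finally show ?thesis by simp
qed

lemma measure_cell: "measure lborel (torus_cell L) = of_int L ^ 3"
  using emeasure_cell L_pos by (simp add: measure_def)

lemma measure_cell_pos: "0 < measure lborel (torus_cell L)"
  using L_pos by (simp add: measure_cell)

lemma cell_finite: "emeasure lborel (torus_cell L) \<noteq> 0" "emeasure lborel (torus_cell L) \<noteq> \<infinity>"
  using L_pos by (simp_all add: emeasure_cell)

sublocale tor: prob_space tor
  unfolding tor_def by (rule prob_space_uniform_measure) (rule cell_finite)+

lemma sets_tor [measurable_cong, simp]: "sets tor = sets borel"
  by (simp add: tor_def)

lemma space_tor [simp]: "space tor = UNIV"
  by (simp add: tor_def)

lemma borel_measurable_tor [simp]: "borel_measurable tor = borel_measurable borel"
  by (rule measurable_cong_sets) auto

lemma AE_lborel_imp_tor: "AE x in lborel. P x \<Longrightarrow> AE x in tor. P x"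
  unfolding tor_def by (rule AE_uniform_measureI) auto

lemma AE_box_lborel: "AE x in lborel. x \<in> torus_cell L \<longrightarrow> x \<in> box 0 (\<chi> i. of_int L)"
proof -
  have sub: "box 0 (\<chi> i. of_int L) \<subseteq> torus_cell L"
    by (simp add: torus_cell_def box_subset_cbox)
  have "emeasure lborel (torus_cell L - box 0 (\<chi> i. of_int L)) = 0"
    using cell_finite by (subst emeasure_Diff) (auto simp: emeasure_box_L sub top_unique)
  then have "torus_cell L - box 0 (\<chi> i. of_int L) \<in> null_sets lborel"
    by (auto simp: null_sets_def)
  from AE_not_in[OF this] show ?thesis by auto
qed

lemma AE_box: "AE x in tor. x \<in> box 0 (\<chi> i. of_int L)"
  unfolding tor_def by (rule AE_uniform_measureI) (use AE_box_lborel in auto)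

lemma box_subset_hcell: "box 0 (\<chi> i. of_int L) \<subseteq> hcell"
  by (auto simp: hcell_def mem_box_cart less_imp_le)

lemma tor_density: "tor = density lborel (\<lambda>x. ennreal (indicator (torus_cell L) x / measure lborel (torus_cell L)))"
proof -
  have "indicator (torus_cell L) x / emeasure lborel (torus_cell L)
     = ennreal (indicator (torus_cell L) x / measure lborel (torus_cell L))" for x
    using L_pos by (auto simp: emeasure_cell measure_cell indicator_def divide_ennreal simp flip: ennreal_1)
  then show ?thesis by (simp add: tor_def uniform_measure_def)
qed

lemma integrable_tor:
  fixes f :: "real^3 \<Rightarrow> 'b :: {banach, second_countable_topology}"
  assumes "f \<in> borel_measurable borel"
  shows "integrable tor f \<longleftrightarrow> set_integrable lborel (torus_cell L) f"
proof -
  let ?c = "measure lborel (torus_cell L)"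
  have "integrable tor f \<longleftrightarrow> integrable lborel (\<lambda>x. (indicator (torus_cell L) x / ?c) *\<^sub>R f x)"
    unfolding tor_density using assms measure_cell_pos by (subst integrable_density) auto
  also have "\<dots> \<longleftrightarrow> set_integrable lborel (torus_cell L) f"
  proof
    assume "integrable lborel (\<lambda>x. (indicator (torus_cell L) x / ?c) *\<^sub>R f x)"
    from integrable_scaleR_right[OF this, of ?c] show "set_integrable lborel (torus_cell L) f"
      using measure_cell_pos by (simp add: set_integrable_def)
  next
    assume "set_integrable lborel (torus_cell L) f"
    then have "integrable lborel (\<lambda>x. (1 / ?c) *\<^sub>R (indicator (torus_cell L) x *\<^sub>R f x))"
      unfolding set_integrable_def by (intro integrable_scaleR_right)
    then show "integrable lborel (\<lambda>x. (indicator (torus_cell L) x / ?c) *\<^sub>R f x)"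
      by simp
  qed
  finally show ?thesis .
qed

lemma integral_tor:
  fixes f :: "real^3 \<Rightarrow> 'b :: {banach, second_countable_topology}"
  assumes "f \<in> borel_measurable borel"
  shows "integral\<^sup>L tor f = (1 / measure lborel (torus_cell L)) *\<^sub>R (LINT x:torus_cell L|lborel. f x)"
proof -
  let ?c = "measure lborel (torus_cell L)"
  have "integral\<^sup>L tor f = (\<integral>x. (indicator (torus_cell L) x / ?c) *\<^sub>R f x \<partial>lborel)"
    unfolding tor_density using assms measure_cell_pos by (subst integral_density) auto
  also have "\<dots> = (\<integral>x. (1 / ?c) *\<^sub>R (indicator (torus_cell L) x *\<^sub>R f x) \<partial>lborel)"
    by (intro Bochner_Integration.integral_cong) auto
  finally show ?thesis
    by (simp only: integral_scaleR_right set_lebesgue_integral_def)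
qed

lemma red_shift: "\<exists>m. red x = x + shift m"
  by (auto simp: red_def)

lemma per_red: "per f \<Longrightarrow> f (red x) = f x"
  using red_shift[of x] by (auto simp: per_def)

lemma tile_unique: "\<exists>!m. x + shift m \<in> hcell"
proof (rule ex1I)
  have *: "x $ i / of_int L - of_int \<lfloor>x $ i / of_int L\<rfloor> \<ge> 0"
    "x $ i / of_int L - of_int \<lfloor>x $ i / of_int L\<rfloor> < 1" for i
    by linarith+
  have "0 \<le> x $ i - of_int L * of_int \<lfloor>x $ i / of_int L\<rfloor>"
       "x $ i - of_int L * of_int \<lfloor>x $ i / of_int L\<rfloor> < of_int L" for i
    using *[of i] L_pos by (auto simp: field_simps)
  then show "x + shift (\<chi> i. - \<lfloor>x $ i / of_int L\<rfloor>) \<in> hcell"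
    by (simp add: hcell_def shift_nth)
next
  fix m assume m: "x + shift m \<in> hcell"
  show "m = (\<chi> i. - \<lfloor>x $ i / of_int L\<rfloor>)"
  proof (rule vec_eq_iff[THEN iffD2], rule allI)
    fix i
    have "0 \<le> x $ i + of_int L * of_int (m $ i)" "x $ i + of_int L * of_int (m $ i) < of_int L"
      using m by (auto simp: hcell_def shift_nth)
    then have "\<lfloor>x $ i / of_int L\<rfloor> = - (m $ i)"
      using L_pos by (intro floor_unique) (auto simp: field_simps)
    then show "m $ i = (\<chi> i. - \<lfloor>x $ i / of_int L\<rfloor>) $ i" by simp
  qed
qed

lemma red_in_hcell: "red x \<in> hcell"
proof -
  have *: "x $ i / of_int L - of_int \<lfloor>x $ i / of_int L\<rfloor> \<ge> 0"
    "x $ i / of_int L - of_int \<lfloor>x $ i / of_int L\<rfloor> < 1" for i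
    by linarith+
  have "0 \<le> x $ i - of_int L * of_int \<lfloor>x $ i / of_int L\<rfloor>"
       "x $ i - of_int L * of_int \<lfloor>x $ i / of_int L\<rfloor> < of_int L" for i
    using *[of i] L_pos by (auto simp: field_simps)
  then show ?thesis
    by (simp add: hcell_def shift_nth red_def)
qed

lemma red_in_cell: "red x \<in> torus_cell L"
  using red_in_hcell hcell_subset by blast

lemma red_measurable [measurable]: "red \<in> borel_measurable borel"
proof -
  have "(\<lambda>x. red x \<bullet> axis i 1) \<in> borel_measurable borel" for i :: 3
  proof -
    have "(\<lambda>x::real^3. x $ i) \<in> borel_measurable borel"
      by (intro borel_measurable_continuous_onI continuous_intros)
    then have [measurable]: "(\<lambda>x::real^3. x $ i) \<in> borel_measurable borel" .
    have "(\<lambda>x::real^3. x $ i - of_int L * of_int \<lfloor>x $ i / of_int L\<rfloor>) \<in> borel_measurable borel"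
      by measurable
    then show ?thesis by (simp add: inner_axis red_def shift_nth)
  qed
  then show ?thesis
    by (subst borel_measurable_euclidean_space) (auto simp: Basis_vec_def)
qed

text \<open>Integrability over the cell says something about one cell only; periodicity carries
  measurability to the whole space.\<close>

lemma borel_from_cell:
  fixes f :: "real^3 \<Rightarrow> real"
  assumes "per f" and "set_integrable lborel (torus_cell L) f"
  shows "f \<in> borel_measurable borel"
proof -
  have [measurable]: "(\<lambda>x. indicator (torus_cell L) x *\<^sub>R f x) \<in> borel_measurable borel"
    using assms(2) unfolding set_integrable_def by (auto dest: borel_measurable_integrable)
  have "(\<lambda>x. indicator (torus_cell L) (red x) *\<^sub>R f (red x)) \<in> borel_measurable borel"
    by measurable
  then show ?thesis
    using red_in_cell by (simp add: per_red[OF assms(1)])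
qed

lemma L1_per_iff: "L1_per L f \<longleftrightarrow> per f \<and> f \<in> borel_measurable borel \<and> integrable tor f"
  using borel_from_cell integrable_tor by (auto simp: L1_per_def periodic_iff_per)

definition enum :: "nat \<Rightarrow> int^3" where
  "enum = from_nat_into UNIV"

lemma bij_enum: "bij enum"
  unfolding enum_def
  by (rule bij_betw_from_nat_into) (auto simp: infinite_UNIV_char_0)

lemma suminf_tile:
  assumes "\<exists>!m. P m"
  shows "(\<Sum>n. indicator {m. P m} (enum n) :: ennreal) = 1"
proof -
  obtain m where m: "{m. P m} = {m}" using assms by auto
  obtain n where n: "enum n = m" using bij_enum by (metis bij_pointE)
  have "enum n' \<noteq> m" if "n' \<noteq> n" for n'
    using bij_enum n that by (metis bij_pointE)
  then have "(\<Sum>n. indicator {m. P m} (enum n) :: ennreal) = sum (\<lambda>n. indicator {m. P m} (enum n)) {n}"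
    by (intro suminf_finite) (auto simp: m)
  also have "\<dots> = 1" by (simp add: m n)
  finally show ?thesis .
qed

lemma nn_integral_lborel_translate:
  fixes f :: "'a :: euclidean_space \<Rightarrow> ennreal"
  assumes [measurable]: "f \<in> borel_measurable borel"
  shows "(\<integral>\<^sup>+x. f (c + x) \<partial>lborel) = (\<integral>\<^sup>+x. f x \<partial>lborel)"
proof -
  have "(\<integral>\<^sup>+x. f x \<partial>lborel) = (\<integral>\<^sup>+x. f x \<partial>distr lborel borel ((+) c))"
    by (simp add: lborel_distr_plus)
  also have "\<dots> = (\<integral>\<^sup>+x. f (c + x) \<partial>lborel)"
    by (rule nn_integral_distr) auto
  finally show ?thesis by simp
qed

text \<open>Cut \<open>A\<close> along the lattice translates of \<open>B\<close> and move every piece into \<open>B\<close>; read backwards this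
  cuts \<open>B\<close> along the translates of \<open>A\<close>.\<close>

lemma nn_integral_fundamental_domains:
  fixes f :: "real^3 \<Rightarrow> ennreal"
  assumes f [measurable]: "f \<in> borel_measurable borel" and pf: "per f"
    and A [measurable]: "A \<in> sets borel" and B [measurable]: "B \<in> sets borel"
    and tA: "\<And>x. \<exists>!m. x + shift m \<in> A" and tB: "\<And>x. \<exists>!m. x + shift m \<in> B"
  shows "(\<integral>\<^sup>+x. indicator A x * f x \<partial>lborel) = (\<integral>\<^sup>+x. indicator B x * f x \<partial>lborel)"
proof -
  have tA': "\<exists>!m. - shift m + x \<in> A" for x
  proof -
    obtain m where m: "x + shift m \<in> A" "\<And>m'. x + shift m' \<in> A \<Longrightarrow> m' = m"
      using tA[of x] by auto
    show ?thesis
    proof (rule ex1I[of _ "- m"])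
      show "- shift (- m) + x \<in> A" using m(1) by (simp add: shift_uminus add.commute)
      fix m' assume "- shift m' + x \<in> A"
      then have "- m' = m" by (intro m(2)) (simp add: shift_uminus)
      then show "m' = - m" by auto
    qed
  qed
  have "(\<integral>\<^sup>+x. indicator A x * f x \<partial>lborel)
      = (\<integral>\<^sup>+x. (\<Sum>n. indicator A x * f x * indicator {m. x + shift m \<in> B} (enum n)) \<partial>lborel)"
    by (simp add: suminf_tile[OF tB])
  also have "\<dots> = (\<integral>\<^sup>+x. (\<Sum>n. indicator A x * f x * indicator B (shift (enum n) + x)) \<partial>lborel)"
    by (simp add: indicator_def add.commute)
  also have "\<dots> = (\<Sum>n. \<integral>\<^sup>+x. indicator A x * f x * indicator B (shift (enum n) + x) \<partial>lborel)"
    by (rule nn_integral_suminf) measurable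
  also have "\<dots> = (\<Sum>n. \<integral>\<^sup>+x. indicator B x * f x * indicator A (- shift (enum n) + x) \<partial>lborel)"
  proof (rule suminf_cong)
    fix n
    have fp: "f (- shift (enum n) + x) = f x" for x
      using per_shift[OF pf, of x "- enum n"] by (simp add: shift_uminus)
    have "(\<integral>\<^sup>+x. indicator A x * f x * indicator B (shift (enum n) + x) \<partial>lborel)
      = (\<integral>\<^sup>+x. indicator A (- shift (enum n) + x) * f (- shift (enum n) + x)
             * indicator B (shift (enum n) + (- shift (enum n) + x)) \<partial>lborel)"
      by (rule nn_integral_lborel_translate[symmetric]) measurable
    also have "\<dots> = (\<integral>\<^sup>+x. indicator B x * f x * indicator A (- shift (enum n) + x) \<partial>lborel)"
      using fp by (simp add: mult_ac)
    finally show "(\<integral>\<^sup>+x. indicator A x * f x * indicator B (shift (enum n) + x) \<partial>lborel)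
       = (\<integral>\<^sup>+x. indicator B x * f x * indicator A (- shift (enum n) + x) \<partial>lborel)" .
  qed
  also have "\<dots> = (\<integral>\<^sup>+x. (\<Sum>n. indicator B x * f x * indicator A (- shift (enum n) + x)) \<partial>lborel)"
    by (rule nn_integral_suminf[symmetric]) measurable
  also have "\<dots> = (\<integral>\<^sup>+x. (\<Sum>n. indicator B x * f x * indicator {m. - shift m + x \<in> A} (enum n)) \<partial>lborel)"
    by (simp add: indicator_def)
  also have "\<dots> = (\<integral>\<^sup>+x. indicator B x * f x \<partial>lborel)"
    by (subst ennreal_suminf_cmult) (simp only: suminf_tile[OF tA'] mult_1_right)
  finally show ?thesis .
qed

lemma nn_integral_tor:
  assumes [measurable]: "f \<in> borel_measurable borel"
  shows "integral\<^sup>N tor f = (\<integral>\<^sup>+x. indicator hcell x * f x \<partial>lborel) / emeasure lborel (torus_cell L)"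
proof -
  have "integral\<^sup>N tor f = (\<integral>\<^sup>+x. f x * indicator (torus_cell L) x \<partial>lborel) / emeasure lborel (torus_cell L)"
    unfolding tor_def by (rule nn_integral_uniform_measure) auto
  also have "(\<integral>\<^sup>+x. f x * indicator (torus_cell L) x \<partial>lborel) = (\<integral>\<^sup>+x. indicator hcell x * f x \<partial>lborel)"
    using AE_box_lborel box_subset_hcell hcell_subset
    by (intro nn_integral_cong_AE) (auto elim!: eventually_mono simp: indicator_def)
  finally show ?thesis .
qed

lemma nn_integral_tor_translate:
  assumes f [measurable]: "f \<in> borel_measurable borel" and pf: "per f"
  shows "(\<integral>\<^sup>+x. f (x + y) \<partial>tor) = (\<integral>\<^sup>+x. f x \<partial>tor)"
proof -
  have "(\<integral>\<^sup>+x. indicator hcell x * f (x + y) \<partial>lborel)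
      = (\<integral>\<^sup>+x. indicator hcell (- y + x) * f (- y + x + y) \<partial>lborel)"
    by (rule nn_integral_lborel_translate[symmetric]) measurable
  also have "\<dots> = (\<integral>\<^sup>+x. indicator ((\<lambda>x. - y + x) -` hcell) x * f x \<partial>lborel)"
    by (simp add: indicator_def)
  also have "\<dots> = (\<integral>\<^sup>+x. indicator hcell x * f x \<partial>lborel)"
  proof (rule nn_integral_fundamental_domains)
    show "(\<lambda>x. - y + x) -` hcell \<in> sets borel"
      using measurable_sets[of "\<lambda>x. - y + x" borel borel hcell] by simp
    show "\<exists>!m. x + shift m \<in> (\<lambda>x. - y + x) -` hcell" for x
      using tile_unique[of "- y + x"] by (simp add: add.assoc add.commute[of "- y"] diff_add_eq)
  qed (use pf tile_unique in auto)
  finally show ?thesis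
    by (simp add: nn_integral_tor)
qed

text \<open>Invariance is stated for the measure itself, which yields it at once for functions with values
  in any Banach space.\<close>

lemma distr_translate: "distr tor borel (\<lambda>x. red (x + y)) = tor"
proof (rule measure_eqI)
  fix A assume "A \<in> sets (distr tor borel (\<lambda>x. red (x + y)))"
  then have A [measurable]: "A \<in> sets borel" by simp
  have "emeasure (distr tor borel (\<lambda>x. red (x + y))) A = (\<integral>\<^sup>+x. indicator A (red (x + y)) \<partial>tor)"
    by (simp add: nn_integral_distr flip: nn_integral_indicator)
  also have "\<dots> = (\<integral>\<^sup>+x. indicator A (red x) \<partial>tor)"
  proof (rule nn_integral_tor_translate)
    have "red (x + shift m) = red x" for x m
    proof -
      have "\<lfloor>(x + shift m) $ i / of_int L\<rfloor> = \<lfloor>x $ i / of_int L\<rfloor> + m $ i" for i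
      proof -
        have "(x + shift m) $ i / of_int L = x $ i / of_int L + of_int (m $ i)"
          using L_pos by (simp add: shift_nth field_simps)
        then show ?thesis by simp
      qed
      then show ?thesis
        by (simp add: red_def vec_eq_iff shift_nth algebra_simps)
    qed
    then show "per (\<lambda>x. indicator A (red x) :: ennreal)" by (simp add: per_def)
  qed measurable
  also have "\<dots> = (\<integral>\<^sup>+x. indicator A x \<partial>tor)"
  proof (rule nn_integral_cong_AE)
    have "red x = x" if "x \<in> hcell" for x
    proof -
      obtain m where m: "red x = x + shift m" using red_shift by blast
      have "m = 0"
        using tile_unique[of x] red_in_hcell[of x] that by (metis m add.right_neutral shift_def int_vec_def
            scaleR_zero_right vec_eq_iff vec_lambda_beta zero_index of_int_0)
      then show ?thesis using m by (simp add: vec_eq_iff shift_nth)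
    qed
    then show "AE x in tor. indicator A (red x) = (indicator A x :: ennreal)"
      using AE_box box_subset_hcell by (auto elim!: eventually_mono)
  qed
  also have "\<dots> = emeasure tor A" by simp
  finally show "emeasure (distr tor borel (\<lambda>x. red (x + y))) A = emeasure tor A" .
qed simp

lemma
  fixes f :: "real^3 \<Rightarrow> 'b :: {banach, second_countable_topology}"
  assumes [measurable]: "f \<in> borel_measurable borel" and pf: "per f"
  shows integrable_translate: "integrable tor (\<lambda>x. f (x + y)) \<longleftrightarrow> integrable tor f"
    and integral_translate: "(\<integral>x. f (x + y) \<partial>tor) = (\<integral>x. f x \<partial>tor)"
proof -
  have f': "f (x + y) = f (red (x + y))" for x
    by (simp add: per_red[OF pf])
  show "integrable tor (\<lambda>x. f (x + y)) \<longleftrightarrow> integrable tor f"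
    unfolding f'
    by (subst (2) distr_translate[symmetric, of y], subst integrable_distr_eq) auto
  show "(\<integral>x. f (x + y) \<partial>tor) = (\<integral>x. f x \<partial>tor)"
    unfolding f'
    by (subst (2) distr_translate[symmetric, of y], subst integral_distr) auto
qed

lemma mean_tor:
  assumes "f \<in> borel_measurable borel"
  shows "mean L f = (\<integral>x. f x \<partial>tor)"
  using integral_tor[OF assms] by (simp add: mean_def)

lemma fourier_coeff_tor:
  assumes [measurable]: "f \<in> borel_measurable borel"
  shows "fourier_coeff L f k = (\<integral>x. cis (- (frequency L k \<bullet> x)) * of_real (f x) \<partial>tor)"
proof -
  have [measurable]: "(\<lambda>x. cis (- (frequency L k \<bullet> x))) \<in> borel_measurable borel"
    by (intro borel_measurable_continuous_onI continuous_intros)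
  show ?thesis
    by (subst integral_tor) (auto simp: fourier_coeff_def scaleR_conv_of_real)
qed

section \<open>Fourier coefficients\<close>

definition wave :: "int^3 \<Rightarrow> real^3 \<Rightarrow> complex" where
  "wave k x = cis (frequency L k \<bullet> x)"

definition fc :: "(real^3 \<Rightarrow> real) \<Rightarrow> int^3 \<Rightarrow> complex" where
  "fc f k = (\<integral>x. wave (- k) x * of_real (f x) \<partial>tor)"

lemma frequency_minus: "frequency L (- k) = - frequency L k"
  by (vector frequency_def int_vec_def)

lemma frequency_add: "frequency L (k + l) = frequency L k + frequency L l"
  by (simp add: frequency_def int_vec_def vec_eq_iff distrib_left add_divide_distrib)

lemma frequency_zero [simp]: "frequency L 0 = 0"
  by (vector frequency_def int_vec_def)

lemma frequency_nth: "frequency L k $ i = 2 * pi / of_int L * of_int (k $ i)"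
  by (simp add: frequency_def int_vec_def)

lemma continuous_wave [continuous_intros]: "continuous_on A (wave k)"
  unfolding wave_def by (intro continuous_intros)

lemma borel_wave [measurable]: "wave k \<in> borel_measurable borel"
  by (intro borel_measurable_continuous_onI continuous_intros)

lemma norm_wave [simp]: "cmod (wave k x) = 1"
  by (simp add: wave_def)

lemma wave_add: "wave (k + l) x = wave k x * wave l x"
  by (simp add: wave_def frequency_add inner_add_left cis_mult)

lemma wave_zero [simp]: "wave 0 x = 1"
  by (simp add: wave_def)

lemma cnj_wave: "cnj (wave k x) = wave (- k) x"
  by (simp add: wave_def frequency_minus cis_cnj)

lemma wave_translate: "wave k (x + y) = wave k y * wave k x"
  by (simp add: wave_def inner_add_right cis_mult add.commute)

lemma per_wave: "per (wave k)"
  unfolding per_def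
proof (intro allI)
  fix x m
  have "frequency L k \<bullet> shift m = (\<Sum>i\<in>UNIV. (2 * pi / of_int L * of_int (k $ i)) * of_int (L * m $ i))"
    by (simp add: inner_vec_def frequency_nth shift_nth)
  also have "\<dots> = (\<Sum>i\<in>UNIV. 2 * pi * of_int (k $ i * m $ i))"
    using L_pos by (intro sum.cong) (auto simp: field_simps)
  also have "\<dots> = 2 * pi * of_int (\<Sum>i\<in>UNIV. k $ i * m $ i)"
    by (simp add: sum_distrib_left)
  finally have "wave k (shift m) = 1"
    unfolding wave_def by (simp only: cis_multiple_2pi[OF Ints_of_int])
  then show "wave k (x + shift m) = wave k x"
    by (simp add: wave_translate)
qed

lemma fourier_coeff_fc: "f \<in> borel_measurable borel \<Longrightarrow> fourier_coeff L f k = fc f k"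
  by (simp add: fourier_coeff_tor fc_def wave_def frequency_minus)

lemma integrable_wave_mult:
  fixes f :: "real^3 \<Rightarrow> real"
  assumes "integrable tor f"
  shows "integrable tor (\<lambda>x. wave k x * of_real (f x))"
  by (rule Bochner_Integration.integrable_bound[OF assms])
     (use assms in \<open>auto simp: norm_mult\<close>)

lemma integrable_tor_bounded:
  fixes f :: "real^3 \<Rightarrow> 'b :: {banach, second_countable_topology}"
  assumes "f \<in> borel_measurable borel" "\<And>x. norm (f x) \<le> B"
  shows "integrable tor f"
  using assms by (intro tor.integrable_const_bound[where B = B]) auto

lemma integrable_wave [simp]: "integrable tor (wave k)"
  by (rule integrable_tor_bounded[where B = 1]) auto

text \<open>A translation by \<open>y\<close> multiplies the integral of a wave by the value of the wave at \<open>y\<close>,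
  but must leave it unchanged.\<close>

lemma integral_wave: "(\<integral>x. wave k x \<partial>tor) = (if k = 0 then 1 else 0)"
proof (cases "k = 0")
  case True
  then show ?thesis using tor.prob_space by simp
next
  case False
  then obtain i where i: "k $ i \<noteq> 0" by (auto simp: vec_eq_iff)
  define y :: "real^3" where "y = axis i (of_int L / (2 * of_int (k $ i)))"
  have "frequency L k \<bullet> y = pi"
    using i L_pos by (simp add: y_def inner_axis frequency_nth)
  then have y: "wave k y = -1" by (simp add: wave_def)
  have "(\<integral>x. wave k x \<partial>tor) = (\<integral>x. wave k (x + y) \<partial>tor)"
    by (rule integral_translate[symmetric]) (auto simp: per_wave)
  also have "\<dots> = - (\<integral>x. wave k x \<partial>tor)"
    by (simp add: wave_translate y)
  finally show ?thesis using False by simp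
qed

lemma integral_wave_mult: "(\<integral>x. wave k x * wave l x \<partial>tor) = (if k = - l then 1 else 0)"
  using integral_wave[of "k + l"] by (simp add: wave_add eq_neg_iff_add_eq_0)

text \<open>The squared distance of \<open>f\<close> to a partial sum of its Fourier series is nonnegative.\<close>

lemma Bessel_finite:
  fixes f :: "real^3 \<Rightarrow> real"
  assumes f: "integrable tor f" and f2: "integrable tor (\<lambda>x. (f x)\<^sup>2)" and K: "finite K"
  shows "(\<Sum>k\<in>K. (cmod (fc f k))\<^sup>2) \<le> (\<integral>x. (f x)\<^sup>2 \<partial>tor)"
proof -
  define s where "s x = (\<Sum>k\<in>K. fc f k * wave k x)" for x
  define S where "S = (\<Sum>k\<in>K. (cmod (fc f k))\<^sup>2)"
  have [measurable]: "f \<in> borel_measurable borel" using f by (auto dest: borel_measurable_integrable)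
  have [measurable]: "s \<in> borel_measurable borel" unfolding s_def by measurable
  have sB: "cmod (s x) \<le> (\<Sum>k\<in>K. cmod (fc f k))" for x
    unfolding s_def by (rule order_trans[OF norm_sum]) (simp add: norm_mult)
  have cs: "cnj (s x) = (\<Sum>k\<in>K. cnj (fc f k) * wave (- k) x)" for x
    by (simp add: s_def cnj_wave)
  have [measurable]: "(\<lambda>x. cnj (s x)) \<in> borel_measurable borel" unfolding cs by measurable
  have i1: "integrable tor (\<lambda>x. cnj (s x) * of_real (f x))"
  proof (rule Bochner_Integration.integrable_bound[OF integrable_scaleR_right[OF f, of "\<Sum>k\<in>K. cmod (fc f k)"]])
    show "AE x in tor. norm (cnj (s x) * of_real (f x)) \<le> norm ((\<Sum>k\<in>K. cmod (fc f k)) *\<^sub>R f x)"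
      by (rule AE_I2) (use sB in \<open>simp add: norm_mult abs_mult sum_nonneg mult_right_mono\<close>)
  qed measurable
  have i2: "integrable tor (\<lambda>x. s x * cnj (s x))"
    by (rule integrable_tor_bounded[where B = "(\<Sum>k\<in>K. cmod (fc f k))\<^sup>2"])
       (auto simp: norm_mult power2_eq_square intro!: mult_mono sB sum_nonneg)
  have "(\<integral>x. cnj (s x) * of_real (f x) \<partial>tor) = (\<integral>x. (\<Sum>k\<in>K. cnj (fc f k) * (wave (- k) x * of_real (f x))) \<partial>tor)"
    by (simp add: cs sum_distrib_right mult.assoc)
  also have "\<dots> = (\<Sum>k\<in>K. cnj (fc f k) * fc f k)"
    unfolding fc_def by (subst Bochner_Integration.integral_sum) (auto intro!: integrable_mult_right integrable_wave_mult f)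
  also have "\<dots> = of_real S"
    by (simp only: S_def of_real_sum complex_norm_square mult.commute)
  finally have I1: "(\<integral>x. cnj (s x) * of_real (f x) \<partial>tor) = of_real S" .
  have "(\<integral>x. s x * cnj (s x) \<partial>tor)
     = (\<integral>x. (\<Sum>k\<in>K. \<Sum>l\<in>K. fc f k * cnj (fc f l) * (wave k x * wave (- l) x)) \<partial>tor)"
    unfolding cs unfolding s_def sum_product
    by (intro Bochner_Integration.integral_cong refl sum.cong) (simp only: mult_ac)
  also have "\<dots> = (\<Sum>k\<in>K. \<Sum>l\<in>K. fc f k * cnj (fc f l) * (if k = l then 1 else 0))"
  proof -
    have w: "integrable tor (\<lambda>x. c * (wave k x * wave l x))" for k l c
      by (intro integrable_mult_right) (simp flip: wave_add)
    have "(\<integral>x. (\<Sum>k\<in>K. \<Sum>l\<in>K. fc f k * cnj (fc f l) * (wave k x * wave (- l) x)) \<partial>tor)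
      = (\<Sum>k\<in>K. \<integral>x. (\<Sum>l\<in>K. fc f k * cnj (fc f l) * (wave k x * wave (- l) x)) \<partial>tor)"
      by (rule Bochner_Integration.integral_sum) (intro Bochner_Integration.integrable_sum w)
    also have "\<dots> = (\<Sum>k\<in>K. \<Sum>l\<in>K. \<integral>x. fc f k * cnj (fc f l) * (wave k x * wave (- l) x) \<partial>tor)"
      by (intro sum.cong refl Bochner_Integration.integral_sum w)
    also have "\<dots> = (\<Sum>k\<in>K. \<Sum>l\<in>K. fc f k * cnj (fc f l) * (if k = l then 1 else 0))"
      by (intro sum.cong refl) (simp add: integral_wave_mult)
    finally show ?thesis .
  qed
  also have "\<dots> = of_real S"
  proof -
    have "(\<Sum>l\<in>K. fc f k * cnj (fc f l) * (if k = l then 1 else 0)) = of_real ((cmod (fc f k))\<^sup>2)"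
      if "k \<in> K" for k
    proof -
      have "(\<Sum>l\<in>K. fc f k * cnj (fc f l) * (if k = l then 1 else 0))
        = (\<Sum>l\<in>K. if k = l then fc f k * cnj (fc f l) else 0)"
        by (intro sum.cong) auto
      also have "\<dots> = fc f k * cnj (fc f k)"
        using K that by (simp only: sum.delta' if_True)
      finally show ?thesis by (simp only: complex_norm_square)
    qed
    then show ?thesis by (simp only: S_def of_real_sum cong: sum.cong)
  qed
  finally have I2: "(\<integral>x. s x * cnj (s x) \<partial>tor) = of_real S" .
  have "0 \<le> (\<integral>x. (cmod (of_real (f x) - s x))\<^sup>2 \<partial>tor)" by simp
  also have "\<dots> = (\<integral>x. (f x)\<^sup>2 - 2 * Re (cnj (s x) * of_real (f x)) + Re (s x * cnj (s x)) \<partial>tor)"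
    by (intro Bochner_Integration.integral_cong refl)
       (simp only: cmod_power2, simp add: power2_eq_square algebra_simps)
  also have "\<dots> = (\<integral>x. (f x)\<^sup>2 \<partial>tor) - 2 * Re (of_real S) + Re (of_real S)"
  proof -
    note r1 = integrable_Re[OF i1] and r2 = integrable_Re[OF i2]
    have e1: "(\<integral>x. Re (cnj (s x) * of_real (f x)) \<partial>tor) = Re (of_real S)"
      using integral_Re[OF i1] by (simp only: I1)
    have e2: "(\<integral>x. Re (s x * cnj (s x)) \<partial>tor) = Re (of_real S)"
      using integral_Re[OF i2] by (simp only: I2)
    have "(\<integral>x. (f x)\<^sup>2 - 2 * Re (cnj (s x) * of_real (f x)) + Re (s x * cnj (s x)) \<partial>tor)
      = (\<integral>x. (f x)\<^sup>2 - 2 * Re (cnj (s x) * of_real (f x)) \<partial>tor) + (\<integral>x. Re (s x * cnj (s x)) \<partial>tor)"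
      by (rule Bochner_Integration.integral_add[OF Bochner_Integration.integrable_diff[OF f2 integrable_mult_right[OF r1]] r2])
    also have "(\<integral>x. (f x)\<^sup>2 - 2 * Re (cnj (s x) * of_real (f x)) \<partial>tor)
      = (\<integral>x. (f x)\<^sup>2 \<partial>tor) - (\<integral>x. 2 * Re (cnj (s x) * of_real (f x)) \<partial>tor)"
      by (rule Bochner_Integration.integral_diff[OF f2 integrable_mult_right[OF r1]])
    also have "(\<integral>x. 2 * Re (cnj (s x) * of_real (f x)) \<partial>tor) = 2 * (\<integral>x. Re (cnj (s x) * of_real (f x)) \<partial>tor)"
      by (rule integral_mult_right_zero)
    finally show ?thesis by (simp only: e1 e2)
  qed
  also have "\<dots> = (\<integral>x. (f x)\<^sup>2 \<partial>tor) - S" by simp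
  finally show ?thesis by (simp add: S_def)
qed

lemma Bessel:
  fixes f :: "real^3 \<Rightarrow> real"
  assumes "integrable tor f" and "integrable tor (\<lambda>x. (f x)\<^sup>2)"
  shows "(\<lambda>k. (cmod (fc f k))\<^sup>2) summable_on UNIV"
  by (rule nonneg_bdd_above_summable_on)
     (use Bessel_finite[OF assms] in \<open>auto intro!: bdd_aboveI2\<close>)

section \<open>A function is determined by its Fourier coefficients\<close>

inductive trig_poly :: "(real^3 \<Rightarrow> complex) \<Rightarrow> bool" where
  wave: "trig_poly (\<lambda>x. c * wave k x)"
| add: "trig_poly f \<Longrightarrow> trig_poly g \<Longrightarrow> trig_poly (\<lambda>x. f x + g x)"

lemma trig_poly_const: "trig_poly (\<lambda>x. c)"
  using trig_poly.wave[of c 0] by simp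

lemma trig_poly_wave_mult:
  assumes "trig_poly g"
  shows "trig_poly (\<lambda>x. c * wave k x * g x)"
  using assms
proof induction
  case (wave d l)
  then show ?case using trig_poly.wave[of "c * d" "k + l"] by (simp add: wave_add mult_ac)
next
  case (add f g)
  then show ?case using trig_poly.add[OF add.IH] by (simp add: algebra_simps)
qed

lemma trig_poly_mult:
  assumes "trig_poly f" "trig_poly g"
  shows "trig_poly (\<lambda>x. f x * g x)"
  using assms(1)
proof induction
  case (wave d l)
  then show ?case using trig_poly_wave_mult[OF assms(2)] by simp
next
  case (add f f')
  then show ?case using trig_poly.add[OF add.IH] by (simp add: algebra_simps)
qed

lemma trig_poly_sum: "(\<And>i. i \<in> I \<Longrightarrow> trig_poly (f i)) \<Longrightarrow> trig_poly (\<lambda>x. \<Sum>i\<in>I. f i x)"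
  by (induction I rule: infinite_finite_induct) (auto intro: trig_poly.add trig_poly_const)

text \<open>The coordinates of this map onto a copy of the torus in \<open>\<real>\<^sup>6\<close> are trigonometric polynomials.\<close>

definition circ :: "real^3 \<Rightarrow> (real^3) \<times> (real^3)" where
  "circ x = ((\<chi> i. cos (2 * pi / of_int L * x $ i)), (\<chi> i. sin (2 * pi / of_int L * x $ i)))"

lemma continuous_circ: "continuous_on A circ"
  unfolding circ_def by (intro continuous_intros continuous_on_vec_lambda)

lemma frequency_axis: "frequency L (axis i 1) \<bullet> x = 2 * pi / of_int L * x $ i"
proof -
  have "frequency L (axis i 1) = axis i (2 * pi / of_int L)"
    by (auto simp: vec_eq_iff frequency_nth axis_def)
  then show ?thesis by (simp add: inner_axis')
qed

lemma trig_poly_circ_Basis: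
  assumes "b \<in> Basis"
  shows "trig_poly (\<lambda>x. of_real (circ x \<bullet> b))"
proof -
  from assms consider i where "b = (axis i 1, 0)" | i where "b = (0, axis i 1)"
    by (auto simp: Basis_prod_def Basis_vec_def)
  then show ?thesis
  proof cases
    case 1
    have "(1/2) * wave (axis i 1) x + (1/2) * wave (- axis i 1) x = of_real (circ x \<bullet> b)" for x
      by (simp add: 1 circ_def inner_axis wave_def frequency_minus frequency_axis complex_eq_iff)
    then show ?thesis
      using trig_poly.add[OF trig_poly.wave[of "1/2" "axis i 1"] trig_poly.wave[of "1/2" "- axis i 1"]] by simp
  next
    case 2
    have "(- \<i>/2) * wave (axis i 1) x + (\<i>/2) * wave (- axis i 1) x = of_real (circ x \<bullet> b)" for x
      by (simp add: 2 circ_def inner_axis wave_def frequency_minus frequency_axis complex_eq_iff)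
    then show ?thesis
      using trig_poly.add[OF trig_poly.wave[of "- \<i>/2" "axis i 1"] trig_poly.wave[of "\<i>/2" "- axis i 1"]] by simp
  qed
qed

lemma trig_poly_polynomial:
  assumes "real_polynomial_function p"
  shows "trig_poly (\<lambda>x. of_real (p (circ x)))"
  using assms
proof induction
  case (linear f)
  then interpret bounded_linear f .
  have eq: "f y = (\<Sum>b\<in>Basis. f b * (y \<bullet> b))" for y
  proof -
    have "f y = f (\<Sum>b\<in>Basis. (y \<bullet> b) *\<^sub>R b)" by (simp only: euclidean_representation)
    also have "\<dots> = (\<Sum>b\<in>Basis. f ((y \<bullet> b) *\<^sub>R b))" by (rule sum)
    also have "\<dots> = (\<Sum>b\<in>Basis. f b * (y \<bullet> b))" by (simp add: scaleR mult.commute)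
    finally show ?thesis .
  qed
  have "complex_of_real (f (circ x)) = (\<Sum>b\<in>Basis. of_real (f b) * of_real (circ x \<bullet> b))" for x
    by (subst eq) (simp only: of_real_sum of_real_mult)
  moreover have "trig_poly (\<lambda>x. \<Sum>b\<in>Basis. of_real (f b) * of_real (circ x \<bullet> b))"
    by (intro trig_poly_sum trig_poly_mult trig_poly_const trig_poly_circ_Basis)
  ultimately show ?case by (simp only:)
next
  case (const c)
  then show ?case by (rule trig_poly_const)
next
  case (add f g)
  then show ?case using trig_poly.add by simp
next
  case (mult f g)
  then show ?case using trig_poly_mult by simp
qed

lemma integral_trig_poly_zero:
  fixes h :: "real^3 \<Rightarrow> real"
  assumes "trig_poly f" and h: "integrable tor h" and "\<And>k. fc h k = 0"
  shows "integrable tor (\<lambda>x. f x * of_real (h x)) \<and> (\<integral>x. f x * of_real (h x) \<partial>tor) = 0"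
  using assms(1)
proof induction
  case (wave c k)
  have "(\<integral>x. wave k x * of_real (h x) \<partial>tor) = 0"
    using assms(3)[of "- k"] by (simp add: fc_def)
  then show ?case
    using integrable_wave_mult[OF h, of k] by (simp add: mult.assoc)
next
  case (add f g)
  then show ?case by (simp add: algebra_simps)
qed

lemma circ_inj:
  assumes "circ x = circ y" "x \<in> hcell" "y \<in> hcell"
  shows "x = y"
proof (rule vec_eq_iff[THEN iffD2], rule allI)
  fix i
  have "sin (2 * pi / of_int L * x $ i) = sin (2 * pi / of_int L * y $ i) \<and>
        cos (2 * pi / of_int L * x $ i) = cos (2 * pi / of_int L * y $ i)"
    using assms(1) by (simp add: circ_def vec_eq_iff)
  then obtain n :: int where "2 * pi / of_int L * x $ i = 2 * pi / of_int L * y $ i + 2 * of_int n * pi"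
    by (auto simp: sin_cos_eq_iff)
  then have "2 * pi * x $ i = 2 * pi * (y $ i + of_int n * of_int L)"
    using L_pos by (simp add: field_simps)
  then have n: "x $ i = y $ i + of_int n * of_int L" by simp
  have *: "0 \<le> x $ i" "x $ i < of_int L" "0 \<le> y $ i" "y $ i < of_int L"
    using assms(2,3) by (auto simp: hcell_def)
  have "\<bar>of_int n * of_int L\<bar> < (of_int L :: real)" using n * by linarith
  then have "\<bar>real_of_int n\<bar> < 1" using L_pos by (simp add: abs_mult)
  then have "n = 0" by linarith
  then show "x $ i = y $ i" using n by simp
qed

text \<open>Polynomials composed with \<^const>\<open>circ\<close> are trigonometric polynomials, which \<open>h\<close> annihilates,
  and by Stone-Weierstrass they approximate every continuous function uniformly.\<close>

lemma integral_continuous_circ_zero: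
  fixes h :: "real^3 \<Rightarrow> real" and g :: "(real^3) \<times> (real^3) \<Rightarrow> real"
  assumes h: "integrable tor h" and z: "\<And>k. fc h k = 0" and g: "continuous_on UNIV g"
  shows "(\<integral>x. g (circ x) * h x \<partial>tor) = 0"
proof -
  define S where "S = circ ` torus_cell L"
  have "compact S"
    unfolding S_def by (rule compact_continuous_image[OF continuous_circ]) (simp add: torus_cell_def)
  have red_circ: "circ x \<in> S" if "x \<in> box 0 (\<chi> i. of_int L)" for x
    using that box_subset_hcell hcell_subset by (auto simp: S_def)
  have [measurable]: "h \<in> borel_measurable borel" using h by (auto dest: borel_measurable_integrable)
  have [measurable]: "circ \<in> borel_measurable borel"
    by (intro borel_measurable_continuous_onI continuous_circ)
  have [measurable]: "g \<in> borel_measurable borel"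
    by (intro borel_measurable_continuous_onI g)
  have "compact (g ` S)"
    using \<open>compact S\<close> g by (intro compact_continuous_image) (auto intro: continuous_on_subset)
  then obtain B where B: "\<And>y. y \<in> S \<Longrightarrow> \<bar>g y\<bar> \<le> B"
    using compact_imp_bounded[of "g ` S"] by (auto simp: bounded_iff)
  have gi: "integrable tor (\<lambda>x. g (circ x) * h x)"
  proof (rule Bochner_Integration.integrable_bound[OF integrable_scaleR_right[OF h, of B]])
    show "AE x in tor. norm (g (circ x) * h x) \<le> norm (B *\<^sub>R h x)"
      using AE_box
    proof eventually_elim
      case (elim x)
      have "\<bar>g (circ x)\<bar> \<le> \<bar>B\<bar>" using B[OF red_circ[OF elim]] by simp
      then show ?case by (simp add: abs_mult mult_right_mono)
    qed
  qed measurable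
  have "\<bar>\<integral>x. g (circ x) * h x \<partial>tor\<bar> \<le> e * (\<integral>x. \<bar>h x\<bar> \<partial>tor)" if "0 < e" for e
  proof -
    obtain p where p: "real_polynomial_function p" "\<And>y. y \<in> S \<Longrightarrow> \<bar>g y - p y\<bar> < e"
      using Stone_Weierstrass_real_polynomial_function[OF \<open>compact S\<close> continuous_on_subset[OF g subset_UNIV] \<open>0 < e\<close>]
      by blast
    have P: "integrable tor (\<lambda>x. complex_of_real (p (circ x) * h x))"
      "(\<integral>x. complex_of_real (p (circ x) * h x) \<partial>tor) = 0"
      using integral_trig_poly_zero[OF trig_poly_polynomial[OF p(1)] h z] by simp_all
    then have pi: "integrable tor (\<lambda>x. p (circ x) * h x)"
      and p0: "(\<integral>x. p (circ x) * h x \<partial>tor) = 0"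
      using integrable_Re[OF P(1)] by (simp_all flip: of_real_mult)
    have "\<bar>\<integral>x. g (circ x) * h x \<partial>tor\<bar> = \<bar>\<integral>x. g (circ x) * h x - p (circ x) * h x \<partial>tor\<bar>"
      using gi pi p0 by simp
    also have "\<dots> \<le> (\<integral>x. \<bar>g (circ x) * h x - p (circ x) * h x\<bar> \<partial>tor)"
      by (rule integral_abs_bound)
    also have "\<dots> \<le> (\<integral>x. e * \<bar>h x\<bar> \<partial>tor)"
    proof (rule integral_mono_AE)
      show "AE x in tor. \<bar>g (circ x) * h x - p (circ x) * h x\<bar> \<le> e * \<bar>h x\<bar>"
        using AE_box
      proof eventually_elim
        case (elim x)
        have "\<bar>g (circ x) * h x - p (circ x) * h x\<bar> = \<bar>g (circ x) - p (circ x)\<bar> * \<bar>h x\<bar>"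
          by (simp add: abs_mult flip: left_diff_distrib)
        also have "\<dots> \<le> e * \<bar>h x\<bar>"
          using p(2)[OF red_circ[OF elim]] by (intro mult_right_mono) auto
        finally show ?case .
      qed
    qed (use gi pi h in auto)
    finally show ?thesis by simp
  qed
  note bound = this
  have I0: "0 \<le> (\<integral>x. \<bar>h x\<bar> \<partial>tor)" by simp
  have "\<bar>\<integral>x. g (circ x) * h x \<partial>tor\<bar> \<le> 0 + e" if "0 < e" for e
  proof -
    let ?I = "\<integral>x. \<bar>h x\<bar> \<partial>tor"
    have "\<bar>\<integral>x. g (circ x) * h x \<partial>tor\<bar> \<le> e / (?I + 1) * ?I"
      using that I0 by (intro bound divide_pos_pos add_nonneg_pos) simp_all
    also have "\<dots> \<le> e"
    proof -
      have "e / (I + 1) * I \<le> e" if "0 \<le> I" for I :: real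
        using that \<open>0 < e\<close> by (simp add: field_simps)
      then show ?thesis using I0 by blast
    qed
    finally show ?thesis by simp
  qed
  then have "\<bar>\<integral>x. g (circ x) * h x \<partial>tor\<bar> \<le> 0" by (rule field_le_epsilon)
  then show ?thesis by simp
qed

text \<open>The compact set \<open>circ ` K\<close> is the limit of continuous bump functions, and \<^const>\<open>circ\<close> is
  injective on the cell up to its boundary.\<close>

lemma integral_compact_zero:
  fixes h :: "real^3 \<Rightarrow> real"
  assumes h: "integrable tor h" and z: "\<And>k. fc h k = 0"
    and K: "compact K" "K \<subseteq> box 0 (\<chi> i. of_int L)"
  shows "(\<integral>x. indicator K x * h x \<partial>tor) = 0"
proof (cases "K = {}")
  case False
  define C where "C = circ ` K"
  have C: "closed C" "C \<noteq> {}"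
    unfolding C_def using K False
    by (auto intro!: compact_imp_closed compact_continuous_image continuous_circ)
  define g where "g n y = max 0 (1 - real n * infdist y C)" for n y
  have gc: "continuous_on UNIV (g n)" for n
    unfolding g_def by (intro continuous_intros)
  have [measurable]: "h \<in> borel_measurable borel" using h by (auto dest: borel_measurable_integrable)
  have [measurable]: "circ \<in> borel_measurable borel"
    by (intro borel_measurable_continuous_onI continuous_circ)
  have [measurable]: "g n \<in> borel_measurable borel" for n
    by (intro borel_measurable_continuous_onI gc)
  have [measurable]: "K \<in> sets borel" using K by (simp add: borel_compact)
  have lim: "(\<lambda>n. g n y) \<longlonglongrightarrow> indicator C y" for y
  proof (cases "y \<in> C")
    case True
    then show ?thesis by (simp add: g_def)
  next
    case False
    then have pos: "0 < infdist y C" using C by (simp add: infdist_pos_not_in_closed)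
    then obtain N where N: "1 / infdist y C < real N" using reals_Archimedean2 by blast
    have "g n y = 0" if "N \<le> n" for n
    proof -
      have "1 < real N * infdist y C" using N pos by (simp add: field_simps)
      also have "\<dots> \<le> real n * infdist y C" using that pos by (intro mult_right_mono) auto
      finally show ?thesis by (simp add: g_def)
    qed
    then have "eventually (\<lambda>n. g n y = indicator C y) sequentially"
      using False by (auto simp: eventually_sequentially)
    then show ?thesis by (rule tendsto_eventually)
  qed
  have "(\<lambda>n. \<integral>x. g n (circ x) * h x \<partial>tor) \<longlonglongrightarrow> (\<integral>x. indicator K x * h x \<partial>tor)"
  proof (rule integral_dominated_convergence)
    show "AE x in tor. (\<lambda>n. g n (circ x) * h x) \<longlonglongrightarrow> indicator K x * h x"
      using AE_box
    proof eventually_elim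
      case (elim x)
      have "circ x \<in> C \<longleftrightarrow> x \<in> K"
        unfolding C_def using circ_inj K box_subset_hcell elim by (metis imageE imageI subsetD)
      then have "indicator C (circ x) = (indicator K x :: real)" by (simp add: indicator_def)
      then show ?case using tendsto_mult[OF lim[of "circ x"] tendsto_const[of "h x"]] by simp
    qed
    show "AE x in tor. norm (g n (circ x) * h x) \<le> \<bar>h x\<bar>" for n
    proof (rule AE_I2)
      fix x
      have "\<bar>g n (circ x)\<bar> \<le> 1" by (auto simp: g_def infdist_nonneg)
      then show "norm (g n (circ x) * h x) \<le> \<bar>h x\<bar>"
        by (simp add: abs_mult mult_left_le_one_le)
    qed
  qed (use h in auto)
  then show ?thesis
    using integral_continuous_circ_zero[OF h z gc] by (simp add: LIMSEQ_const_iff)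
qed simp

text \<open>By inner regularity, a set \<open>{h > 0}\<close> of positive measure would contain a compact set of
  positive measure, over which \<open>h\<close> has integral zero.\<close>

lemma nonpos_if_fourier_zero:
  fixes h :: "real^3 \<Rightarrow> real"
  assumes h: "integrable tor h" and z: "\<And>k. fc h k = 0"
  shows "AE x in tor. h x \<le> 0"
proof -
  define B where "B = {x \<in> box 0 (\<chi> i. of_int L). 0 < h x}"
  have [measurable]: "h \<in> borel_measurable borel" using h by (auto dest: borel_measurable_integrable)
  have [measurable]: "B \<in> sets borel" unfolding B_def by measurable
  have "emeasure tor K = 0" if K: "K \<subseteq> B" "compact K" for K
  proof -
    have [measurable]: "K \<in> sets borel" using K by (simp add: borel_compact)
    have nn: "0 \<le> indicator K x * h x" for x using K by (auto simp: B_def indicator_def less_imp_le)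
    have int: "integrable tor (\<lambda>x. indicator K x * h x)"
      using integrable_mult_indicator[OF _ h, of K] by simp
    have "(\<integral>x. indicator K x * h x \<partial>tor) = 0"
      using K by (intro integral_compact_zero h z) (auto simp: B_def)
    then have "AE x in tor. indicator K x * h x = 0"
      using integral_nonneg_eq_0_iff_AE[OF int] nn by simp
    then have "AE x in tor. x \<notin> K"
      using K by (auto elim!: eventually_mono simp: B_def indicator_def split: if_splits)
    then show ?thesis by (simp add: AE_iff_null_sets null_setsD1)
  qed
  then have "emeasure tor B = 0"
    using inner_regular[of tor B] tor.emeasure_finite
    by (auto simp flip: bot_ennreal intro!: SUP_eq_const cong: SUP_cong_simp)
  then have "AE x in tor. x \<notin> B" by (intro AE_not_in) (simp add: null_sets_def)
  with AE_box show ?thesis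
    by eventually_elim (auto simp: B_def)
qed

lemma fc_minus: "fc (\<lambda>x. - f x) k = - fc f k"
  by (simp add: fc_def)

lemma fc_diff: "integrable tor f \<Longrightarrow> integrable tor g \<Longrightarrow> fc (\<lambda>x. f x - g x) k = fc f k - fc g k"
  unfolding fc_def by (simp add: right_diff_distrib integrable_wave_mult)

lemma fc_add: "integrable tor f \<Longrightarrow> integrable tor g \<Longrightarrow> fc (\<lambda>x. f x + g x) k = fc f k + fc g k"
  unfolding fc_def by (simp add: distrib_left integrable_wave_mult)

lemma fc_cmult: "fc (\<lambda>x. c * f x) k = of_real c * fc f k"
  unfolding fc_def by (simp add: mult.left_commute)

lemma fc_const: "fc (\<lambda>x. c) k = (if k = 0 then of_real c else 0)"
  unfolding fc_def by (simp add: integral_wave)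

lemma fourier_unique:
  fixes f g :: "real^3 \<Rightarrow> real"
  assumes f: "integrable tor f" and g: "integrable tor g" and eq: "\<And>k. fc f k = fc g k"
  shows "AE x in tor. f x = g x"
proof -
  have "AE x in tor. f x - g x \<le> 0"
    by (rule nonpos_if_fourier_zero) (use f g eq in \<open>auto simp: fc_diff\<close>)
  moreover have "AE x in tor. g x - f x \<le> 0"
    by (rule nonpos_if_fourier_zero) (use f g eq in \<open>auto simp: fc_diff\<close>)
  ultimately show ?thesis by eventually_elim auto
qed

end

section \<open>The resolvent of the Laplacian as an averaging operator\<close>

text \<open>Averaging over the translates by such a \<open>P\<close> is the operator \<open>lam (lam - \<Delta>)\<^sup>-\<^sup>1\<close>, since the
  characteristic function of \<open>P\<close> is its Fourier multiplier.  The Green's function enters the proof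
  through its multiplier and its positivity, and a probability measure captures both without a
  formula for the density.\<close>

definition resolvent_kernel :: "real \<Rightarrow> (real^3) measure \<Rightarrow> bool" where
  "resolvent_kernel lam P \<longleftrightarrow> prob_space P \<and> sets P = sets borel \<and>
     (\<forall>\<xi>. (\<integral>y. cis (\<xi> \<bullet> y) \<partial>P) = of_real (lam / (lam + (norm \<xi>)\<^sup>2)))"

lemma integral_pair_mult:
  fixes g :: "'a \<Rightarrow> complex" and h :: "'b \<Rightarrow> complex"
  assumes "prob_space A" "prob_space B"
    and [measurable]: "g \<in> borel_measurable A" "h \<in> borel_measurable B"
    and bg: "\<And>x. cmod (g x) \<le> 1" and bh: "\<And>x. cmod (h x) \<le> 1"
  shows "(\<integral>z. g (fst z) * h (snd z) \<partial>(A \<Otimes>\<^sub>M B)) = (\<integral>x. g x \<partial>A) * (\<integral>x. h x \<partial>B)"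
proof -
  interpret A: prob_space A by fact
  interpret B: prob_space B by fact
  interpret pair_prob_space A B ..
  have "cmod (g (fst z) * h (snd z)) \<le> 1" for z
    using mult_mono[OF bg[of "fst z"] bh[of "snd z"]] by (simp add: norm_mult)
  then have "integrable (A \<Otimes>\<^sub>M B) (\<lambda>z. g (fst z) * h (snd z))"
    by (intro integrable_const_bound[where B = 1]) auto
  from integral_fst'[OF this] show ?thesis by simp
qed

lemma integral_std_normal_cis: "(\<integral>x. cis (u * x) \<partial>std_normal_distribution) = of_real (exp (- u\<^sup>2 / 2))"
  using fun_cong[OF char_std_normal_distribution, of u]
  by (simp add: char_def cis_conv_exp)

lemma norm_real3: "(norm (x :: real^3))\<^sup>2 = (x $ 1)\<^sup>2 + (x $ 2)\<^sup>2 + (x $ 3)\<^sup>2"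
  by (simp add: norm_vec_def L2_set_def sum_3)

lemma integral_exponential_exp:
  assumes "0 < l" "0 \<le> s"
  shows "(\<integral>t. exp (- t * s) \<partial>density lborel (exponential_density l)) = l / (l + s)"
proof -
  interpret E: prob_space "density lborel (exponential_density (l + s))"
    using assms by (intro prob_space_exponential_density) auto
  have "1 = (\<integral>t. (1::real) \<partial>density lborel (exponential_density (l + s)))"
    using E.prob_space by simp
  also have "\<dots> = (\<integral>t. exponential_density (l + s) t \<partial>lborel)"
    using assms by (subst integral_density) (auto simp: exponential_density_nonneg)
  finally have 1: "(\<integral>t. exponential_density (l + s) t \<partial>lborel) = 1" ..
  have "(\<integral>t. exp (- t * s) \<partial>density lborel (exponential_density l))
      = (\<integral>t. exponential_density l t *\<^sub>R exp (- t * s) \<partial>lborel)"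
    using assms by (subst integral_density) (auto simp: exponential_density_nonneg)
  also have "\<dots> = (\<integral>t. (l / (l + s)) * exponential_density (l + s) t \<partial>lborel)"
  proof (rule Bochner_Integration.integral_cong[OF refl])
    fix t
    have "exp (- t * l) * exp (- t * s) = exp (- t * (l + s))"
      by (simp add: algebra_simps flip: exp_add)
    then show "exponential_density l t *\<^sub>R exp (- t * s) = (l / (l + s)) * exponential_density (l + s) t"
      using assms by (simp add: exponential_density_def)
  qed
  finally show ?thesis using 1 by simp
qed

text \<open>Brownian motion stopped at an independent exponential time: the law of \<open>sqrt (2 T) Z\<close> with \<open>T\<close>
  exponential of rate \<open>lam\<close> and \<open>Z\<close> standard normal in \<open>\<real>\<^sup>3\<close>.  Given \<open>T = t\<close>, its characteristic
  function is the heat multiplier \<open>exp (- t (norm \<xi>)\<^sup>2)\<close>, and averaging over \<open>t\<close> turns the heat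
  semigroup into the resolvent.\<close>

lemma resolvent_kernel_exists:
  assumes "0 < lam"
  shows "\<exists>P. resolvent_kernel lam P"
proof -
  let ?E = "density lborel (exponential_density lam)"
  let ?G = "std_normal_distribution"
  let ?N = "?G \<Otimes>\<^sub>M (?G \<Otimes>\<^sub>M ?G)"
  define X :: "real \<times> real \<times> real \<times> real \<Rightarrow> real^3" where
    "X = (\<lambda>(t, a, b, c). sqrt (2 * t) *\<^sub>R (a *\<^sub>R axis 1 1 + b *\<^sub>R axis 2 1 + c *\<^sub>R axis 3 1))"
  have pE: "prob_space ?E" using assms by (rule prob_space_exponential_density)
  have pG: "prob_space ?G" by (rule prob_space_normal_density) simp
  interpret E: prob_space ?E by (rule pE)
  interpret G: prob_space ?G by (rule pG)
  interpret GG: pair_prob_space ?G ?G ..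
  interpret N: pair_prob_space ?G "?G \<Otimes>\<^sub>M ?G" ..
  interpret EN: pair_prob_space ?E ?N ..
  have X [measurable]: "X \<in> borel_measurable (?E \<Otimes>\<^sub>M ?N)"
    unfolding X_def by measurable
  define P where "P = distr (?E \<Otimes>\<^sub>M ?N) borel X"
  have "prob_space P" unfolding P_def by (rule EN.prob_space_distr) (rule X)
  moreover have "sets P = sets borel" by (simp add: P_def)
  moreover have "(\<integral>y. cis (\<xi> \<bullet> y) \<partial>P) = of_real (lam / (lam + (norm \<xi>)\<^sup>2))" for \<xi>
  proof -
    have [measurable]: "cis \<in> borel_measurable borel"
      by (intro borel_measurable_continuous_onI continuous_intros)
    have inner: "(\<integral>z. cis (\<xi> \<bullet> X (t, z)) \<partial>?N) = of_real (exp (- t * (norm \<xi>)\<^sup>2))" if "0 \<le> t" for t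
    proof -
      let ?s = "sqrt (2 * t)"
      have "\<xi> \<bullet> X (t, z) = ?s * \<xi> $ 1 * fst z + (?s * \<xi> $ 2 * fst (snd z) + ?s * \<xi> $ 3 * snd (snd z))" for z
        by (cases z) (simp add: X_def inner_add_right inner_axis algebra_simps)
      then have "(\<integral>z. cis (\<xi> \<bullet> X (t, z)) \<partial>?N)
        = (\<integral>z. cis (?s * \<xi> $ 1 * fst z) * (\<lambda>w. cis (?s * \<xi> $ 2 * fst w) * cis (?s * \<xi> $ 3 * snd w)) (snd z) \<partial>?N)"
        by (simp add: cis_mult)
      also have "\<dots> = (\<integral>x. cis (?s * \<xi> $ 1 * x) \<partial>?G)
            * (\<integral>w. cis (?s * \<xi> $ 2 * fst w) * cis (?s * \<xi> $ 3 * snd w) \<partial>(?G \<Otimes>\<^sub>M ?G))"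
        by (rule integral_pair_mult) (auto simp: norm_mult intro: pG GG.prob_space_axioms)
      also have "(\<integral>w. cis (?s * \<xi> $ 2 * fst w) * cis (?s * \<xi> $ 3 * snd w) \<partial>(?G \<Otimes>\<^sub>M ?G))
         = (\<integral>x. cis (?s * \<xi> $ 2 * x) \<partial>?G) * (\<integral>x. cis (?s * \<xi> $ 3 * x) \<partial>?G)"
        by (rule integral_pair_mult) (auto intro: pG)
      finally have "(\<integral>z. cis (\<xi> \<bullet> X (t, z)) \<partial>?N)
        = of_real (exp (- (?s * \<xi> $ 1)\<^sup>2 / 2) * (exp (- (?s * \<xi> $ 2)\<^sup>2 / 2) * exp (- (?s * \<xi> $ 3)\<^sup>2 / 2)))"
        by (simp only: integral_std_normal_cis of_real_mult)
      also have "exp (- (?s * \<xi> $ 1)\<^sup>2 / 2) * (exp (- (?s * \<xi> $ 2)\<^sup>2 / 2) * exp (- (?s * \<xi> $ 3)\<^sup>2 / 2))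
         = exp (- t * (norm \<xi>)\<^sup>2)"
        using that by (simp add: norm_real3 power_mult_distrib algebra_simps flip: exp_add)
      finally show ?thesis .
    qed
    have t0: "AE t in ?E. 0 \<le> t"
      by (subst AE_density) (auto simp: exponential_density_def)
    have "integrable (?E \<Otimes>\<^sub>M ?N) (\<lambda>z. cis (\<xi> \<bullet> X z))"
      by (intro EN.integrable_const_bound[where B = 1]) auto
    from EN.integral_fst'[OF this]
    have "(\<integral>y. cis (\<xi> \<bullet> y) \<partial>P) = (\<integral>t. (\<integral>z. cis (\<xi> \<bullet> X (t, z)) \<partial>?N) \<partial>?E)"
      unfolding P_def by (subst integral_distr) auto
    also have "\<dots> = (\<integral>t. of_real (exp (- t * (norm \<xi>)\<^sup>2)) \<partial>?E)"
      using t0 by (intro integral_cong_AE) (auto elim!: eventually_mono simp: inner)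
    also have "\<dots> = of_real (lam / (lam + (norm \<xi>)\<^sup>2))"
      by (simp only: integral_complex_of_real integral_exponential_exp[OF assms] zero_le_power2)
    finally show ?thesis .
  qed
  ultimately show ?thesis by (auto simp: resolvent_kernel_def)
qed

definition conv :: "(real^3) measure \<Rightarrow> (real^3 \<Rightarrow> 'b) \<Rightarrow> real^3 \<Rightarrow> 'b :: {banach, second_countable_topology}" where
  "conv P f x = (\<integral>y. f (x + y) \<partial>P)"

definition refl_measure :: "(real^3) measure \<Rightarrow> (real^3) measure" where
  "refl_measure P = distr P borel uminus"

lemma resolvent_kernel_refl:
  assumes "resolvent_kernel lam P"
  shows "resolvent_kernel lam (refl_measure P)"
proof -
  have P: "prob_space P" "sets P = sets borel"
    "\<And>\<xi>. (\<integral>y. cis (\<xi> \<bullet> y) \<partial>P) = of_real (lam / (lam + (norm \<xi>)\<^sup>2))"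
    using assms by (auto simp: resolvent_kernel_def)
  note [measurable_cong] = P(2)
  have [measurable]: "(\<lambda>y. cis (\<xi> \<bullet> y)) \<in> borel_measurable borel" for \<xi> :: "real^3"
    by (intro borel_measurable_continuous_onI continuous_intros)
  have "(\<integral>y. cis (\<xi> \<bullet> y) \<partial>refl_measure P) = (\<integral>y. cis ((- \<xi>) \<bullet> y) \<partial>P)" for \<xi>
    unfolding refl_measure_def by (subst integral_distr) auto
  also have "(\<integral>y. cis ((- \<xi>) \<bullet> y) \<partial>P) = of_real (lam / (lam + (norm \<xi>)\<^sup>2))" for \<xi>
    by (subst P(3)) simp
  finally show ?thesis
    using prob_space.prob_space_distr[OF P(1), of uminus borel]
    by (simp add: resolvent_kernel_def refl_measure_def)
qed

context torus
begin

lemma L1_perD: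
  assumes "L1_per L f"
  shows "per f" "f \<in> borel_measurable borel" "integrable tor f"
  using assms by (auto simp: L1_per_iff)

lemma L1_perI:
  "per f \<Longrightarrow> f \<in> borel_measurable borel \<Longrightarrow> integrable tor f \<Longrightarrow> L1_per L f"
  by (auto simp: L1_per_iff)

lemma L1_per_bounded:
  "per f \<Longrightarrow> f \<in> borel_measurable borel \<Longrightarrow> (\<And>x. \<bar>f x\<bar> \<le> B) \<Longrightarrow> L1_per L f"
  by (intro L1_perI integrable_tor_bounded[where B = B]) auto

lemma L1_per_const: "L1_per L (\<lambda>x. c)"
  by (intro L1_perI) (auto simp: per_def)

lemma L1_per_add: "L1_per L f \<Longrightarrow> L1_per L g \<Longrightarrow> L1_per L (\<lambda>x. f x + g x)"
  by (auto simp: L1_per_iff per_def)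

lemma L1_per_diff: "L1_per L f \<Longrightarrow> L1_per L g \<Longrightarrow> L1_per L (\<lambda>x. f x - g x)"
  by (auto simp: L1_per_iff per_def)

lemma L1_per_cmult: "L1_per L f \<Longrightarrow> L1_per L (\<lambda>x. c * f x)"
  by (auto simp: L1_per_iff per_def)

lemma per_conv: "per f \<Longrightarrow> per (conv P f)"
  by (auto simp: per_def conv_def add.assoc add.commute[of "shift _"])
     (auto simp flip: add.assoc)

lemma borel_conv [measurable]:
  assumes "resolvent_kernel lam P" and [measurable]: "f \<in> borel_measurable borel"
  shows "conv P f \<in> borel_measurable borel"
proof -
  interpret Q: prob_space P using assms(1) by (simp add: resolvent_kernel_def)
  have [measurable_cong]: "sets P = sets borel" using assms(1) by (simp add: resolvent_kernel_def)
  show ?thesis unfolding conv_def by measurable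
qed

lemma integrable_pair_translate:
  fixes f :: "real^3 \<Rightarrow> 'b :: {banach, second_countable_topology}"
  assumes P: "resolvent_kernel lam P"
    and f: "per f" and [measurable]: "f \<in> borel_measurable borel" and int: "integrable tor f"
  shows "integrable (tor \<Otimes>\<^sub>M P) (\<lambda>z. f (fst z + snd z))"
proof -
  interpret Q: prob_space P using P by (simp add: resolvent_kernel_def)
  have [measurable_cong]: "sets P = sets borel" using P by (simp add: resolvent_kernel_def)
  interpret pair_sigma_finite tor P ..
  show ?thesis
  proof (rule integrableI_bounded)
    have "(\<integral>\<^sup>+z. ennreal (norm (f (fst z + snd z))) \<partial>(tor \<Otimes>\<^sub>M P))
        = (\<integral>\<^sup>+y. (\<integral>\<^sup>+x. ennreal (norm (f (x + y))) \<partial>tor) \<partial>P)"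
      by (subst nn_integral_snd[symmetric]) auto
    also have "\<dots> = (\<integral>\<^sup>+y. (\<integral>\<^sup>+x. ennreal (norm (f x)) \<partial>tor) \<partial>P)"
      using f by (intro nn_integral_cong nn_integral_tor_translate) (auto simp: per_def)
    also have "\<dots> = (\<integral>\<^sup>+x. ennreal (norm (f x)) \<partial>tor)"
      by (simp add: Q.emeasure_space_1)
    also have "\<dots> < \<infinity>" using int by (simp add: integrable_iff_bounded)
    finally show "(\<integral>\<^sup>+z. ennreal (norm (f (fst z + snd z))) \<partial>(tor \<Otimes>\<^sub>M P)) < \<infinity>" .
  qed measurable
qed

lemma conv_L1:
  assumes P: "resolvent_kernel lam P" and f: "L1_per L f"
  shows "L1_per L (conv P f)"
    and "AE x in tor. integrable P (\<lambda>y. f (x + y))"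
proof -
  interpret Q: prob_space P using P by (simp add: resolvent_kernel_def)
  interpret pair_sigma_finite tor P ..
  note int = integrable_pair_translate[OF P L1_perD[OF f]]
  show "AE x in tor. integrable P (\<lambda>y. f (x + y))"
    using AE_integrable_fst'[OF int] by simp
  show "L1_per L (conv P f)"
    using integrable_fst'[OF int] L1_perD[OF f]
    by (intro L1_perI per_conv borel_conv[OF P]) (auto simp: conv_def[abs_def])
qed

text \<open>Fubini and translation invariance: after exchanging the integrals, \<open>x\<close> is replaced by
  \<open>x - y\<close> in the inner one.\<close>

lemma conv_adjoint:
  fixes f h :: "real^3 \<Rightarrow> 'b :: {banach, second_countable_topology, real_normed_field}"
  assumes P: "resolvent_kernel lam P"
    and f: "per f" and f_borel [measurable]: "f \<in> borel_measurable borel" and int: "integrable tor f"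
    and h: "per h" and h_borel [measurable]: "h \<in> borel_measurable borel" and B: "\<And>x. norm (h x) \<le> B"
  shows "(\<integral>x. conv P f x * h x \<partial>tor) = (\<integral>x. f x * conv (refl_measure P) h x \<partial>tor)"
proof -
  interpret Q: prob_space P using P by (simp add: resolvent_kernel_def)
  have [measurable_cong]: "sets P = sets borel" using P by (simp add: resolvent_kernel_def)
  interpret pair_sigma_finite tor P ..
  have B0: "0 \<le> B" using B[of 0] norm_ge_zero order_trans by blast
  have nb: "norm (a * h z) \<le> norm (B *\<^sub>R a)" for a z
    using mult_right_mono[OF B[of z] norm_ge_zero[of a]] B0 by (simp add: norm_mult mult.commute)
  have i1: "integrable (tor \<Otimes>\<^sub>M P) (\<lambda>(x, y). f (x + y) * h x)"
    by (rule Bochner_Integration.integrable_bound[OF integrable_scaleR_right[OF integrable_pair_translate[OF P f f_borel int], of B]])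
       (measurable, rule AE_I2, simp only: case_prod_beta nb)
  have "integrable (tor \<Otimes>\<^sub>M P) (\<lambda>z. f (fst z))"
    using int by (intro integrableI_bounded) (auto simp: integrable_iff_bounded Q.nn_integral_fst[symmetric] Q.emeasure_space_1)
  then have i2: "integrable (tor \<Otimes>\<^sub>M P) (\<lambda>(x, y). f x * h (x - y))"
    by (rule Bochner_Integration.integrable_bound[OF integrable_scaleR_right[where c = B]])
       (measurable, rule AE_I2, simp only: case_prod_beta nb)
  have "(\<integral>x. conv P f x * h x \<partial>tor) = (\<integral>x. (\<integral>y. f (x + y) * h x \<partial>P) \<partial>tor)"
    by (simp add: conv_def)
  also have "\<dots> = (\<integral>y. (\<integral>x. f (x + y) * h x \<partial>tor) \<partial>P)"
    by (rule Fubini_integral[OF i1, symmetric])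
  also have "\<dots> = (\<integral>y. (\<integral>x. f x * h (x - y) \<partial>tor) \<partial>P)"
  proof (rule Bochner_Integration.integral_cong[OF refl])
    fix y
    have "(\<integral>x. (\<lambda>x. f x * h (x - y)) (x + y) \<partial>tor) = (\<integral>x. f x * h (x - y) \<partial>tor)"
    proof (rule integral_translate)
      have "h (x + shift m - y) = h (x - y)" for x m
        using per_shift[OF h, of "x - y" m] by (simp add: algebra_simps)
      then show "per (\<lambda>x. f x * h (x - y))" using f by (simp add: per_def)
    qed measurable
    then show "(\<integral>x. f (x + y) * h x \<partial>tor) = (\<integral>x. f x * h (x - y) \<partial>tor)" by simp
  qed
  also have "\<dots> = (\<integral>x. (\<integral>y. f x * h (x - y) \<partial>P) \<partial>tor)"
    by (rule Fubini_integral[OF i2])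
  also have "\<dots> = (\<integral>x. f x * conv (refl_measure P) h x \<partial>tor)"
    unfolding conv_def refl_measure_def by (subst integral_distr) auto
  finally show ?thesis .
qed

lemma fc_conv:
  assumes P: "resolvent_kernel lam P" and f: "L1_per L f"
  shows "fc (conv P f) k = of_real (lam / (lam + (norm (frequency L k))\<^sup>2)) * fc f k"
proof -
  note F = L1_perD[OF f]
  have [measurable]: "f \<in> borel_measurable borel" by (rule F)
  have of_real: "conv P (\<lambda>x. complex_of_real (f x)) x = of_real (conv P f x)" for x
    by (simp add: conv_def)
  have w: "conv (refl_measure P) (wave (- k)) x = of_real (lam / (lam + (norm (frequency L k))\<^sup>2)) * wave (- k) x" for x
  proof -
    have "conv (refl_measure P) (wave (- k)) x = wave (- k) x * (\<integral>y. cis ((- frequency L k) \<bullet> y) \<partial>refl_measure P)"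
    proof -
      have "conv (refl_measure P) (wave (- k)) x = (\<integral>y. wave (- k) x * wave (- k) y \<partial>refl_measure P)"
        unfolding conv_def by (simp add: wave_translate mult.commute)
      then show ?thesis by (simp add: wave_def frequency_minus)
    qed
    also have "(\<integral>y. cis ((- frequency L k) \<bullet> y) \<partial>refl_measure P)
        = of_real (lam / (lam + (norm (- frequency L k))\<^sup>2))"
      using resolvent_kernel_refl[OF P] unfolding resolvent_kernel_def by blast
    finally show ?thesis by (simp add: mult.commute)
  qed
  have "fc (conv P f) k = (\<integral>x. conv P (\<lambda>x. complex_of_real (f x)) x * wave (- k) x \<partial>tor)"
    by (simp add: fc_def of_real mult.commute)
  also have "\<dots> = (\<integral>x. complex_of_real (f x) * conv (refl_measure P) (wave (- k)) x \<partial>tor)"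
    using F by (intro conv_adjoint[OF P, where B = 1]) (auto simp: per_wave, auto simp: per_def)
  also have "\<dots> = of_real (lam / (lam + (norm (frequency L k))\<^sup>2)) * fc f k"
    unfolding w fc_def integral_mult_right_zero[symmetric] by (simp only: mult_ac)
  finally show ?thesis .
qed

text \<open>This is \<open>(lam - \<Delta>)\<^sup>-\<^sup>1\<close>.\<close>

definition resolvent :: "real \<Rightarrow> (real^3 \<Rightarrow> real) \<Rightarrow> real^3 \<Rightarrow> real" where
  "resolvent lam f x = conv (SOME P. resolvent_kernel lam P) f x / lam"

context
  fixes lam :: real
  assumes lam: "0 < lam"
begin

definition "kern = (SOME P. resolvent_kernel lam P)"

lemma kern: "resolvent_kernel lam kern"
  unfolding kern_def using resolvent_kernel_exists[OF lam] by (rule someI_ex)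

lemma resolvent_eq: "resolvent lam f x = conv kern f x / lam"
  by (simp add: resolvent_def kern_def)

lemma resolvent_L1: "L1_per L f \<Longrightarrow> L1_per L (resolvent lam f)"
  using L1_per_cmult[OF conv_L1(1)[OF kern], of f "1 / lam"] by (simp add: resolvent_eq[abs_def])

lemma fc_resolvent:
  assumes "L1_per L f"
  shows "fc (resolvent lam f) k = fc f k / of_real (lam + (norm (frequency L k))\<^sup>2)"
proof -
  have "fc (resolvent lam f) k = of_real (1 / lam) * fc (conv kern f) k"
    unfolding fc_cmult[symmetric] by (simp add: resolvent_eq[abs_def])
  also have "\<dots> = fc f k / of_real (lam + (norm (frequency L k))\<^sup>2)"
    using lam by (simp add: fc_conv[OF kern assms])
  finally show ?thesis .
qed

lemma integral_resolvent:
  assumes "L1_per L f"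
  shows "(\<integral>x. resolvent lam f x \<partial>tor) = (\<integral>x. f x \<partial>tor) / lam"
proof -
  have "complex_of_real (\<integral>x. resolvent lam f x \<partial>tor) = of_real ((\<integral>x. f x \<partial>tor) / lam)"
    using fc_resolvent[OF assms, of 0] by (simp add: fc_def)
  then show ?thesis by (simp only: of_real_eq_iff)
qed

text \<open>Replacing \<open>f\<close> by \<open>min f g\<close> makes the inequality hold everywhere, so that the averages can be
  compared pointwise; it changes the resolvent only on a null set because it does not change the
  Fourier coefficients.\<close>

lemma resolvent_mono_AE:
  assumes f: "L1_per L f" and g: "L1_per L g" and le: "AE x in tor. f x \<le> g x"
  shows "AE x in tor. resolvent lam f x \<le> resolvent lam g x"
proof -
  let ?m = "\<lambda>x. min (f x) (g x)"
  note F = L1_perD[OF f] and G = L1_perD[OF g]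
  have m: "L1_per L ?m"
    using F G by (intro L1_perI) (auto simp: per_def)
  have [measurable]: "f \<in> borel_measurable borel" "g \<in> borel_measurable borel" by (rule F G)+
  have "fc ?m k = fc f k" for k
    unfolding fc_def using le by (intro integral_cong_AE) (auto simp: min_absorb1 elim!: eventually_mono)
  then have "AE x in tor. resolvent lam ?m x = resolvent lam f x"
    by (intro fourier_unique L1_perD(3)[OF resolvent_L1] m f) (simp add: fc_resolvent m f)
  moreover have "AE x in tor. resolvent lam ?m x \<le> resolvent lam g x"
    using conv_L1(2)[OF kern m] conv_L1(2)[OF kern g]
  proof eventually_elim
    case (elim x)
    then have "conv kern ?m x \<le> conv kern g x"
      unfolding conv_def by (intro integral_mono) auto
    then show ?case using lam by (simp add: resolvent_eq divide_right_mono)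
  qed
  ultimately show ?thesis by eventually_elim simp
qed

lemma integrable_kern_bounded:
  fixes f :: "real^3 \<Rightarrow> real"
  assumes "f \<in> borel_measurable borel" "\<And>x. \<bar>f x\<bar> \<le> B"
  shows "integrable kern (\<lambda>y. f (x + y))"
proof -
  interpret prob_space kern using kern by (simp add: resolvent_kernel_def)
  have [measurable_cong]: "sets kern = sets borel" using kern by (simp add: resolvent_kernel_def)
  show ?thesis using assms by (intro integrable_const_bound[where B = B]) auto
qed

lemma resolvent_const: "resolvent lam (\<lambda>x. c) x = c / lam"
proof -
  interpret prob_space kern using kern by (simp add: resolvent_kernel_def)
  show ?thesis by (simp add: resolvent_eq conv_def prob_space)
qed

lemma resolvent_mono:
  assumes "f \<in> borel_measurable borel" "\<And>x. \<bar>f x\<bar> \<le> B" "g \<in> borel_measurable borel" "\<And>x. \<bar>g x\<bar> \<le> B'"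
    and "\<And>x. f x \<le> g x"
  shows "resolvent lam f x \<le> resolvent lam g x"
  using lam integrable_kern_bounded[OF assms(1,2)] integrable_kern_bounded[OF assms(3,4)] assms(5)
  by (auto simp: resolvent_eq conv_def intro!: divide_right_mono integral_mono)

lemma resolvent_tendsto:
  assumes "\<And>n. f n \<in> borel_measurable borel" "g \<in> borel_measurable borel" "\<And>n x. \<bar>f n x\<bar> \<le> B"
    and "\<And>x. (\<lambda>n. f n x) \<longlonglongrightarrow> g x"
  shows "(\<lambda>n. resolvent lam (f n) x) \<longlonglongrightarrow> resolvent lam g x"
proof -
  interpret prob_space kern using kern by (simp add: resolvent_kernel_def)
  have [measurable_cong]: "sets kern = sets borel" using kern by (simp add: resolvent_kernel_def)
  note [measurable] = assms(1,2)
  have "(\<lambda>n. conv kern (f n) x) \<longlonglongrightarrow> conv kern g x"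
    unfolding conv_def using assms(3,4)
    by (intro integral_dominated_convergence[where w = "\<lambda>_. B"]) auto
  then show ?thesis
    unfolding resolvent_eq using lam by (intro tendsto_divide) auto
qed

end

section \<open>The weak Laplacian in Fourier space\<close>

lemma per_continuous_bounded:
  fixes f :: "real^3 \<Rightarrow> real"
  assumes "per f" "continuous_on UNIV f"
  obtains B where "\<And>x. \<bar>f x\<bar> \<le> B"
proof -
  have "compact (f ` torus_cell L)"
    by (intro compact_continuous_image continuous_on_subset[OF assms(2)]) (auto simp: torus_cell_def)
  then obtain B where "\<And>x. x \<in> torus_cell L \<Longrightarrow> \<bar>f x\<bar> \<le> B"
    using compact_imp_bounded[of "f ` torus_cell L"] by (auto simp: bounded_iff)
  then have "\<bar>f (red x)\<bar> \<le> B" for x by (simp add: red_in_cell)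
  then show ?thesis using that[of B] per_red[OF assms(1)] by simp
qed

lemma L1_per_continuous: "per f \<Longrightarrow> continuous_on UNIV f \<Longrightarrow> L1_per L f"
  using per_continuous_bounded[of f] L1_per_bounded[of f] borel_measurable_continuous_onI[of f] by blast

lemma integrable_mult_continuous:
  fixes f g :: "real^3 \<Rightarrow> real"
  assumes f: "integrable tor f" and g: "per g" "continuous_on UNIV g"
  shows "integrable tor (\<lambda>x. f x * g x)"
proof -
  obtain B where B: "\<And>x. \<bar>g x\<bar> \<le> B" using per_continuous_bounded[OF g] by blast
  have [measurable]: "f \<in> borel_measurable borel" "g \<in> borel_measurable borel"
    using f g by (auto dest: borel_measurable_integrable intro: borel_measurable_continuous_onI)
  have "\<bar>f x * g x\<bar> \<le> \<bar>B * f x\<bar>" for x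
    using mult_right_mono[OF order_trans[OF B abs_ge_self], of "\<bar>f x\<bar>" x] by (simp add: abs_mult mult.commute)
  then show ?thesis
    by (intro Bochner_Integration.integrable_bound[OF integrable_mult_right[OF f, of B]]) auto
qed

lemma partial_deriv_DERIV:
  assumes "f differentiable (at (x + s *\<^sub>R axis i 1))"
  shows "((\<lambda>t. f (x + t *\<^sub>R axis i 1)) has_real_derivative partial_deriv i f (x + s *\<^sub>R axis i 1)) (at s)"
proof -
  let ?y = "x + s *\<^sub>R axis i 1"
  obtain D where D: "(f has_derivative D) (at ?y)" using assms by (auto simp: differentiable_def)
  interpret D: bounded_linear D using D by (rule has_derivative_bounded_linear)
  have *: "((\<lambda>t. f (z + t *\<^sub>R axis i 1)) has_real_derivative D (axis i 1)) (at t0)"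
    if "z + t0 *\<^sub>R axis i 1 = ?y" for z t0
  proof -
    have "((\<lambda>t. z + t *\<^sub>R axis i 1) has_derivative (\<lambda>t. t *\<^sub>R axis i 1)) (at t0)"
      by (auto intro!: derivative_eq_intros)
    from has_derivative_compose[OF this, of f D] D that
    have "((\<lambda>t. f (z + t *\<^sub>R axis i 1)) has_derivative (\<lambda>t. D (t *\<^sub>R axis i 1))) (at t0)"
      by simp
    moreover have "(\<lambda>t. D (t *\<^sub>R axis i 1)) = (*) (D (axis i 1))"
      by (simp add: D.scaleR fun_eq_iff)
    ultimately show ?thesis
      by (simp only: has_field_derivative_def)
  qed
  have "partial_deriv i f ?y = D (axis i 1)"
    unfolding partial_deriv_def by (rule DERIV_imp_deriv, rule *) simp
  then show ?thesis using * by simp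
qed

lemma partial_deriv_eqI:
  "((\<lambda>t. f (x + t *\<^sub>R axis i 1)) has_real_derivative D) (at 0) \<Longrightarrow> partial_deriv i f x = D"
  unfolding partial_deriv_def by (rule DERIV_imp_deriv)

lemma per_partial_deriv: "per f \<Longrightarrow> per (partial_deriv i f)"
  by (simp add: per_def partial_deriv_def add.assoc add.commute[of "shift _"]) (simp flip: add.assoc)

text \<open>The difference quotients of a periodic function have integral zero.\<close>

lemma integral_partial_deriv:
  assumes h: "per h" and d: "\<And>x. h differentiable (at x)" and c: "continuous_on UNIV (partial_deriv i h)"
  shows "(\<integral>x. partial_deriv i h x \<partial>tor) = 0"
proof -
  let ?e = "axis i 1 :: real^3"
  define q where "q n x = (h (x + inverse (real (Suc n)) *\<^sub>R ?e) - h x) / inverse (real (Suc n))" for n x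
  have hc: "continuous_on UNIV h"
    using d by (auto simp: continuous_on_eq_continuous_at intro: differentiable_imp_continuous_within)
  have [measurable]: "h \<in> borel_measurable borel" "partial_deriv i h \<in> borel_measurable borel"
    by (intro borel_measurable_continuous_onI hc c)+
  have hi: "integrable tor h" using L1_perD L1_per_continuous[OF h hc] by blast
  obtain B where B: "\<And>x. \<bar>partial_deriv i h x\<bar> \<le> B"
    using per_continuous_bounded[OF per_partial_deriv[OF h] c] by blast
  have D: "((\<lambda>t. h (x + t *\<^sub>R ?e)) has_real_derivative partial_deriv i h (x + s *\<^sub>R ?e)) (at s)" for x s
    by (rule partial_deriv_DERIV[OF d])
  have "(\<lambda>n. \<integral>x. q n x \<partial>tor) \<longlonglongrightarrow> (\<integral>x. partial_deriv i h x \<partial>tor)"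
  proof (rule integral_dominated_convergence)
    have "(\<lambda>n. q n x) \<longlonglongrightarrow> partial_deriv i h x" for x
    proof -
      have "((\<lambda>t. (h (x + t *\<^sub>R ?e) - h x) / t) \<longlongrightarrow> partial_deriv i h x) (at 0)"
        using D[of x 0] by (simp add: has_field_derivative_iff)
      moreover have "filterlim (\<lambda>n. inverse (real (Suc n))) (at 0) sequentially"
        by (rule filterlim_atI) (use LIMSEQ_inverse_real_of_nat in auto)
      ultimately show ?thesis
        unfolding q_def by (rule filterlim_compose)
    qed
    then show "AE x in tor. (\<lambda>n. q n x) \<longlonglongrightarrow> partial_deriv i h x" by simp
    have "\<bar>q n x\<bar> \<le> B" for n x
    proof -
      let ?t = "inverse (real (Suc n))"
      have "0 < ?t" by simp
      then obtain z where "h (x + ?t *\<^sub>R ?e) - h (x + 0 *\<^sub>R ?e) = (?t - 0) * partial_deriv i h (x + z *\<^sub>R ?e)"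
        using MVT2[of 0 ?t "\<lambda>t. h (x + t *\<^sub>R ?e)" "\<lambda>s. partial_deriv i h (x + s *\<^sub>R ?e)"] D by blast
      then have "q n x = partial_deriv i h (x + z *\<^sub>R ?e)" by (simp add: q_def)
      then show ?thesis using B by simp
    qed
    then show "AE x in tor. norm (q n x) \<le> B" for n by simp
  qed (auto simp: q_def)
  moreover have "(\<integral>x. q n x \<partial>tor) = 0" for n
  proof -
    have hi': "integrable tor (\<lambda>x. h (x + y))" for y
      using integrable_translate[of h y] h hi by simp
    have "(\<integral>x. q n x \<partial>tor) = ((\<integral>x. h (x + inverse (real (Suc n)) *\<^sub>R ?e) \<partial>tor) - (\<integral>x. h x \<partial>tor)) / inverse (real (Suc n))"
      unfolding q_def using hi hi' by simp
    then show ?thesis using integral_translate[of h] h by simp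
  qed
  ultimately show ?thesis by (simp add: LIMSEQ_const_iff)
qed

lemma test_functionD:
  assumes "test_function L \<psi>"
  shows "per \<psi>" "\<psi> differentiable (at x)" "continuous_on UNIV \<psi>" "test_function L (partial_deriv i \<psi>)"
proof -
  have C: "Ck n \<psi>" for n using assms by (simp add: test_function_def)
  show p: "per \<psi>" using assms by (simp add: test_function_def periodic_iff_per)
  show "\<psi> differentiable (at x)" using C[of 1] by simp
  show "continuous_on UNIV \<psi>" using C[of 0] by simp
  show "test_function L (partial_deriv i \<psi>)"
    using C[of "Suc n" for n] per_partial_deriv[OF p] by (auto simp: test_function_def periodic_iff_per)
qed

lemma integral_by_parts:
  assumes \<psi>: "test_function L \<psi>" and \<eta>: "test_function L \<eta>"
  shows "(\<integral>x. partial_deriv i \<psi> x * \<eta> x \<partial>tor) = - (\<integral>x. \<psi> x * partial_deriv i \<eta> x \<partial>tor)"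
proof -
  note A = test_functionD[OF \<psi>] and B = test_functionD[OF \<eta>]
  note A' = test_functionD[OF A(4)[of i]] and B' = test_functionD[OF B(4)[of i]]
  let ?h = "\<lambda>x. \<psi> x * \<eta> x"
  have eq: "partial_deriv i ?h x = partial_deriv i \<psi> x * \<eta> x + \<psi> x * partial_deriv i \<eta> x" for x
    using DERIV_mult[OF partial_deriv_DERIV[of \<psi> x 0 i] partial_deriv_DERIV[of \<eta> x 0 i]] A(2) B(2)
    by (intro partial_deriv_eqI) (simp add: mult.commute)
  have "0 = (\<integral>x. partial_deriv i ?h x \<partial>tor)"
    using A B A' B' by (intro integral_partial_deriv[symmetric])
      (auto simp: eq[abs_def] per_def intro!: continuous_intros)
  also have "\<dots> = (\<integral>x. partial_deriv i \<psi> x * \<eta> x \<partial>tor) + (\<integral>x. \<psi> x * partial_deriv i \<eta> x \<partial>tor)"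
    unfolding eq using A B A' B'
    by (intro Bochner_Integration.integral_add integrable_mult_continuous L1_perD(3)[OF L1_per_continuous])
  finally show ?thesis by simp
qed

lemma laplacian_continuous: "test_function L \<psi> \<Longrightarrow> continuous_on UNIV (laplacian \<psi>)"
  unfolding laplacian_def[abs_def] by (intro continuous_intros test_functionD(3) test_functionD(4))

lemma laplacian_per: "test_function L \<psi> \<Longrightarrow> per (laplacian \<psi>)"
  using per_partial_deriv[OF per_partial_deriv[OF test_functionD(1)]] by (simp add: per_def laplacian_def)

lemma Green_identity:
  assumes \<psi>: "test_function L \<psi>" and \<eta>: "test_function L \<eta>"
  shows "(\<integral>x. laplacian \<psi> x * \<eta> x \<partial>tor) = (\<integral>x. \<psi> x * laplacian \<eta> x \<partial>tor)"
proof -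
  note T = test_functionD
  have int: "integrable tor (\<lambda>x. f x * g x)" if "test_function L f" "test_function L g" for f g
    using T[OF that(1)] T[OF that(2)] by (intro integrable_mult_continuous L1_perD(3)[OF L1_per_continuous])
  have "(\<integral>x. laplacian \<psi> x * \<eta> x \<partial>tor) = (\<Sum>i\<in>UNIV. \<integral>x. partial_deriv i (partial_deriv i \<psi>) x * \<eta> x \<partial>tor)"
    unfolding laplacian_def sum_distrib_right
    by (intro Bochner_Integration.integral_sum int T(4) \<psi> \<eta>)
  also have "\<dots> = (\<Sum>i\<in>UNIV. \<integral>x. \<psi> x * partial_deriv i (partial_deriv i \<eta>) x \<partial>tor)"
    by (intro sum.cong refl) (simp add: integral_by_parts T(4) \<psi> \<eta>)
  also have "\<dots> = (\<integral>x. \<psi> x * laplacian \<eta> x \<partial>tor)"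
    unfolding laplacian_def sum_distrib_left
    by (intro Bochner_Integration.integral_sum[symmetric] int T(4) \<psi> \<eta>)
  finally show ?thesis .
qed

definition trig :: "real \<Rightarrow> real \<Rightarrow> int^3 \<Rightarrow> real^3 \<Rightarrow> real" where
  "trig a b k x = a * Re (wave k x) + b * Im (wave k x)"

lemma trig_DERIV:
  "((\<lambda>t. trig a b k (x + t *\<^sub>R axis i 1)) has_real_derivative
     trig (b * frequency L k $ i) (- a * frequency L k $ i) k x) (at 0)"
  unfolding trig_def wave_def
  by (auto simp: inner_add_right inner_axis intro!: derivative_eq_intros)

lemma partial_deriv_trig:
  "partial_deriv i (trig a b k) = trig (b * frequency L k $ i) (- a * frequency L k $ i) k"
  by (rule ext) (rule partial_deriv_eqI[OF trig_DERIV])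

lemma continuous_trig: "continuous_on UNIV (trig a b k)"
  unfolding trig_def by (intro continuous_intros)

lemma differentiable_trig: "trig a b k differentiable (at x)"
proof -
  have "(\<lambda>x. a * cos (frequency L k \<bullet> x) + b * sin (frequency L k \<bullet> x)) differentiable (at x)"
    unfolding differentiable_def by (rule exI) (auto intro!: derivative_eq_intros)
  then show ?thesis by (simp add: trig_def[abs_def] wave_def)
qed

lemma test_function_trig: "test_function L (trig a b k)"
proof -
  have "Ck n (trig a b k)" for n
    by (induction n arbitrary: a b) (simp_all add: continuous_trig differentiable_trig partial_deriv_trig)
  then show ?thesis
    using per_wave by (simp add: test_function_def periodic_iff_per) (simp add: per_def trig_def)
qed

lemma laplacian_trig: "laplacian (trig a b k) x = - (norm (frequency L k))\<^sup>2 * trig a b k x"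
proof -
  have "laplacian (trig a b k) x = (\<Sum>i\<in>UNIV. - (frequency L k $ i)\<^sup>2 * trig a b k x)"
    unfolding laplacian_def partial_deriv_trig by (intro sum.cong refl) (simp add: trig_def power2_eq_square algebra_simps)
  also have "\<dots> = - (norm (frequency L k))\<^sup>2 * trig a b k x"
    by (simp add: norm_real3 sum_3 algebra_simps)
  finally show ?thesis .
qed

lemma fc_trig:
  assumes f: "integrable tor f"
  shows "fc f k = Complex (\<integral>x. f x * trig 1 0 k x \<partial>tor) (- (\<integral>x. f x * trig 0 1 k x \<partial>tor))"
proof -
  note i = integrable_wave_mult[OF f, of "- k"]
  have "Re (fc f k) = (\<integral>x. f x * trig 1 0 k x \<partial>tor)"
    unfolding fc_def integral_Re[OF i, symmetric] by (simp add: trig_def cnj_wave[symmetric] mult.commute)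
  moreover have "Im (fc f k) = - (\<integral>x. f x * trig 0 1 k x \<partial>tor)"
    unfolding fc_def integral_Im[OF i, symmetric] by (simp add: trig_def cnj_wave[symmetric] mult.commute)
  ultimately show ?thesis by (simp add: complex_eq_iff)
qed

lemma fc_laplacian:
  assumes f: "integrable tor f" and g: "integrable tor g"
    and "\<And>a b. (\<integral>x. f x * laplacian (trig a b k) x \<partial>tor) = (\<integral>x. g x * trig a b k x \<partial>tor)"
  shows "fc g k = - of_real ((norm (frequency L k))\<^sup>2) * fc f k"
proof -
  let ?s = "(norm (frequency L k))\<^sup>2"
  have "(\<integral>x. g x * trig a b k x \<partial>tor) = - ?s * (\<integral>x. f x * trig a b k x \<partial>tor)" for a b
    unfolding assms(3)[symmetric] laplacian_trig integral_mult_right_zero[symmetric]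
    by (intro Bochner_Integration.integral_cong refl) (simp only: mult_ac)
  then show ?thesis
    by (simp add: fc_trig[OF f] fc_trig[OF g] complex_eq_iff)
qed

lemma weak_laplacian_tor:
  "weak_laplacian L f g \<longleftrightarrow> L1_per L f \<and> L1_per L g \<and>
     (\<forall>\<psi>. test_function L \<psi> \<longrightarrow> (\<integral>x. f x * laplacian \<psi> x \<partial>tor) = (\<integral>x. g x * \<psi> x \<partial>tor))"
proof -
  have "(LINT x:torus_cell L|lborel. f x * laplacian \<psi> x) = (LINT x:torus_cell L|lborel. g x * \<psi> x)
     \<longleftrightarrow> (\<integral>x. f x * laplacian \<psi> x \<partial>tor) = (\<integral>x. g x * \<psi> x \<partial>tor)"
    if "L1_per L f" "L1_per L g" "test_function L \<psi>" for \<psi>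
  proof -
    have [measurable]: "f \<in> borel_measurable borel" "g \<in> borel_measurable borel"
      "\<psi> \<in> borel_measurable borel" "laplacian \<psi> \<in> borel_measurable borel"
      using that L1_perD laplacian_continuous test_functionD
      by (auto intro: borel_measurable_continuous_onI)
    show ?thesis
      using measure_cell_pos by (simp add: integral_tor)
  qed
  then show ?thesis unfolding weak_laplacian_def by blast
qed

lemma weak_laplacian_fourier:
  "weak_laplacian L f g \<Longrightarrow> fc g k = - of_real ((norm (frequency L k))\<^sup>2) * fc f k"
  by (rule fc_laplacian) (auto simp: weak_laplacian_tor test_function_trig dest: L1_perD)

text \<open>If \<open>q = f - g\<close>, then \<open>f\<close> is the average of \<open>q\<close>, and a test function \<open>\<psi>\<close> is the
  adjoint average of \<open>\<psi> - \<Delta>\<psi>\<close>.  Moving the averaging from one factor to the other replaces the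
  convergence of the Fourier series of \<open>\<psi>\<close>.\<close>

lemma weak_laplacianI_fourier:
  assumes f: "L1_per L f" and g: "L1_per L g"
    and fg: "\<And>k. fc g k = - of_real ((norm (frequency L k))\<^sup>2) * fc f k"
  shows "weak_laplacian L f g"
proof -
  obtain P where P: "resolvent_kernel 1 P" using resolvent_kernel_exists[of 1] by auto
  note R = resolvent_kernel_refl[OF P]
  have pos: "1 + complex_of_real ((norm (frequency L k))\<^sup>2) \<noteq> 0" for k
    by (metis add_pos_nonneg of_real_1 of_real_add of_real_eq_0_iff less_irrefl zero_le_power2 zero_less_one)
  have inv: "fc (conv Q h) k = fc \<psi> k"
    if "resolvent_kernel 1 Q" "L1_per L h" "fc h k = (1 + of_real ((norm (frequency L k))\<^sup>2)) * fc \<psi> k" for Q h \<psi> k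
    using pos[of k] by (simp add: fc_conv[OF that(1,2)] that(3))
  define q where "q x = f x - g x" for x
  have q: "L1_per L q" unfolding q_def using f g by (rule L1_per_diff)
  have "fc q k = (1 + of_real ((norm (frequency L k))\<^sup>2)) * fc f k" for k
    unfolding q_def using L1_perD(3)[OF f] L1_perD(3)[OF g] by (simp add: fc_diff fg algebra_simps)
  then have fq: "AE x in tor. conv P q x = f x"
    by (intro fourier_unique inv[OF P q] L1_perD(3)[OF conv_L1(1)[OF P q]] L1_perD(3)[OF f]) 
  have [measurable]: "f \<in> borel_measurable borel" "g \<in> borel_measurable borel" "q \<in> borel_measurable borel"
    by (intro L1_perD(2) f g q)+
  have "(\<integral>x. f x * laplacian \<psi> x \<partial>tor) = (\<integral>x. g x * \<psi> x \<partial>tor)" if \<psi>: "test_function L \<psi>" for \<psi>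
  proof -
    note T = test_functionD[OF \<psi>] and Lc = laplacian_continuous[OF \<psi>] and Lp = laplacian_per[OF \<psi>]
    define h where "h x = \<psi> x - laplacian \<psi> x" for x
    have h: "per h" "continuous_on UNIV h"
      using T Lc Lp unfolding h_def by (auto simp: per_def intro!: continuous_intros)
    obtain B where B: "\<And>x. \<bar>h x\<bar> \<le> B" using per_continuous_bounded[OF h] by blast
    have [measurable]: "h \<in> borel_measurable borel" "\<psi> \<in> borel_measurable borel"
      using h T by (auto intro: borel_measurable_continuous_onI)
    have hL: "L1_per L h" by (rule L1_per_continuous[OF h])
    have \<psi>L: "L1_per L \<psi>" and LL: "L1_per L (laplacian \<psi>)" using T Lp Lc by (auto intro: L1_per_continuous)
    have "fc (laplacian \<psi>) k = - of_real ((norm (frequency L k))\<^sup>2) * fc \<psi> k" for k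
      by (rule fc_laplacian[OF L1_perD(3)[OF \<psi>L] L1_perD(3)[OF LL]])
         (rule Green_identity[OF \<psi> test_function_trig, symmetric])
    then have "fc h k = (1 + of_real ((norm (frequency L k))\<^sup>2)) * fc \<psi> k" for k
      unfolding h_def using L1_perD(3)[OF \<psi>L] L1_perD(3)[OF LL] by (simp add: fc_diff algebra_simps)
    then have h\<psi>: "AE x in tor. conv (refl_measure P) h x = \<psi> x"
      by (intro fourier_unique inv[OF R hL] L1_perD(3)[OF conv_L1(1)[OF R hL]] L1_perD(3)[OF \<psi>L])
    have [measurable]: "conv P q \<in> borel_measurable borel" "conv (refl_measure P) h \<in> borel_measurable borel"
      by (intro borel_conv[OF P] borel_conv[OF R]; measurable)+
    have "(\<integral>x. f x * h x \<partial>tor) = (\<integral>x. conv P q x * h x \<partial>tor)"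
      using fq by (intro integral_cong_AE) (auto elim!: eventually_mono)
    also have "\<dots> = (\<integral>x. q x * conv (refl_measure P) h x \<partial>tor)"
      by (rule conv_adjoint[OF P L1_perD[OF q] h(1), where B = B]) (use B in auto)
    also have "\<dots> = (\<integral>x. q x * \<psi> x \<partial>tor)"
      using h\<psi> by (intro integral_cong_AE) (auto elim!: eventually_mono)
    finally have "(\<integral>x. f x * \<psi> x - f x * laplacian \<psi> x \<partial>tor) = (\<integral>x. f x * \<psi> x - g x * \<psi> x \<partial>tor)"
      by (simp add: h_def q_def algebra_simps)
    moreover have "integrable tor (\<lambda>x. f x * \<psi> x)" "integrable tor (\<lambda>x. g x * \<psi> x)"
      "integrable tor (\<lambda>x. f x * laplacian \<psi> x)"
      using T Lp Lc L1_perD(3)[OF f] L1_perD(3)[OF g] by (auto intro!: integrable_mult_continuous)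
    ultimately show ?thesis by simp
  qed
  then show ?thesis using f g by (simp add: weak_laplacian_tor)
qed

lemma weak_laplacian_sobolev:
  assumes w: "weak_laplacian L f g"
    and f2: "integrable tor (\<lambda>x. (f x)\<^sup>2)" and g2: "integrable tor (\<lambda>x. (g x)\<^sup>2)"
  shows "in_sobolev L 2 f"
proof -
  have f: "L1_per L f" and g: "L1_per L g" using w by (auto simp: weak_laplacian_def)
  have "(\<lambda>k. 2 * (cmod (fc f k))\<^sup>2 + 2 * (cmod (fc g k))\<^sup>2) summable_on UNIV"
    by (intro summable_on_add summable_on_cmult_right Bessel L1_perD(3) f g f2 g2)
  then have "(\<lambda>k. (1 + (norm (frequency L k))\<^sup>2) powr 2 * (cmod (fc f k))\<^sup>2) summable_on UNIV"
  proof (rule summable_on_comparison_test)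
    fix k
    let ?s = "(norm (frequency L k))\<^sup>2" and ?c = "cmod (fc f k)"
    have "0 \<le> (?s * ?c - ?c)\<^sup>2" by simp
    then have "(1 + ?s)\<^sup>2 * ?c\<^sup>2 \<le> 2 * ?c\<^sup>2 + 2 * (?s * ?c)\<^sup>2"
      by (simp add: power2_eq_square algebra_simps)
    moreover have "cmod (fc g k) = ?s * ?c"
      by (simp add: weak_laplacian_fourier[OF w] norm_mult norm_power)
    moreover have "0 < 1 + ?s" by (intro add_pos_nonneg) auto
    ultimately show "(1 + ?s) powr 2 * ?c\<^sup>2 \<le> 2 * ?c\<^sup>2 + 2 * (cmod (fc g k))\<^sup>2"
      by (simp add: powr_numeral)
  qed auto
  then show ?thesis
    using f L1_perD(2)[OF f] by (simp add: in_sobolev_def fourier_coeff_fc)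
qed

end

section \<open>A bounded solution of Poisson's equation\<close>

lemma sum_int_abs_le:
  fixes b :: "nat \<Rightarrow> real"
  assumes b: "summable b" and nn: "\<And>n. 0 \<le> b n"
  shows "finite I \<Longrightarrow> (\<Sum>n\<in>I. b (nat \<bar>n\<bar>)) \<le> 2 * suminf b"
proof -
  assume I: "finite I"
  define N where "N = (\<Sum>n\<in>I. nat \<bar>n\<bar>)"
  have le: "nat \<bar>n\<bar> \<le> N" if "n \<in> I" for n
    unfolding N_def using I that by (intro member_le_sum) auto
  have "I \<subseteq> int ` {..N} \<union> (\<lambda>n. - int n) ` {..N}"
  proof
    fix n assume "n \<in> I"
    then show "n \<in> int ` {..N} \<union> (\<lambda>n. - int n) ` {..N}"
      using le[of n] by (cases "0 \<le> n") (auto intro!: image_eqI[of _ _ "nat \<bar>n\<bar>"])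
  qed
  then have "(\<Sum>n\<in>I. b (nat \<bar>n\<bar>)) \<le> (\<Sum>n\<in>int ` {..N} \<union> (\<lambda>n. - int n) ` {..N}. b (nat \<bar>n\<bar>))"
    using nn by (intro sum_mono2) auto
  also have "\<dots> \<le> (\<Sum>n\<in>int ` {..N}. b (nat \<bar>n\<bar>)) + (\<Sum>n\<in>(\<lambda>n. - int n) ` {..N}. b (nat \<bar>n\<bar>))"
    using nn by (subst sum_Un) (auto intro!: sum_nonneg)
  also have "\<dots> = (\<Sum>n\<le>N. b n) + (\<Sum>n\<le>N. b n)"
    by (simp add: sum.reindex inj_on_def)
  also have "\<dots> \<le> 2 * suminf b"
    using sum_le_suminf[OF b, of "{..N}"] nn by simp
  finally show ?thesis .
qed

lemma inverse_le_shifted: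
  fixes s c :: real
  assumes "0 < c" "c\<^sup>2 \<le> s"
  shows "1 / s \<le> (1 + 1 / c\<^sup>2) / (1 + s)"
proof -
  have c2: "0 < c\<^sup>2" using assms(1) by simp
  then have s: "0 < s" using assms(2) by linarith
  have "1 \<le> s / c\<^sup>2" using assms(2) c2 by (simp add: le_divide_eq_1_pos)
  then have "1 + s \<le> (1 + 1 / c\<^sup>2) * s" by (simp add: distrib_right)
  then show ?thesis using s by (simp add: pos_le_divide_eq pos_divide_le_eq)
qed

context torus
begin

text \<open>Every coordinate satisfies \<open>1 + \<xi>\<^sub>i\<^sup>2 \<le> 1 + (norm \<xi>)\<^sup>2\<close>, so the summand is at most the product of the
  three factors \<open>(1 + \<xi>\<^sub>i\<^sup>2) powr (- 2 / 3)\<close>, and the sum at most the cube of a sum over \<open>\<int>\<close>, which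
  converges since \<open>4 / 3 > 1\<close>.\<close>

lemma lattice_summable:
  "(\<lambda>k. 1 / (1 + (norm (frequency L k))\<^sup>2)\<^sup>2) summable_on UNIV"
proof -
  define c where "c = 2 * pi / of_int L"
  have c: "0 < c" using L_pos by (simp add: c_def)
  define b where "b n = (1 + (c * real n)\<^sup>2) powr (-2/3)" for n
  have b0: "0 \<le> b n" for n by (simp add: b_def)
  have "summable b"
  proof (rule summable_comparison_test')
    show "summable (\<lambda>n. c powr (-4/3) * real n powr (-4/3))"
      by (intro summable_mult) (simp add: summable_real_powr_iff)
    fix n :: nat assume n: "1 \<le> n"
    have "b n \<le> ((c * real n)\<^sup>2) powr (-2/3)"
      unfolding b_def using c n by (intro powr_mono2') auto
    also have "\<dots> = (c * real n) powr (2 * (-2/3))"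
      using c n by (subst powr_powr[symmetric]) (simp add: powr_numeral)
    also have "\<dots> = c powr (-4/3) * real n powr (-4/3)"
      using c n by (simp add: powr_mult)
    finally show "norm (b n) \<le> c powr (-4/3) * real n powr (-4/3)"
      using b0 by simp
  qed
  define d where "d n = b (nat \<bar>n\<bar>)" for n :: int
  have d: "d n = (1 + (c * of_int n)\<^sup>2) powr (-2/3)" for n
    by (simp add: d_def b_def power_mult_distrib)
  have le: "1 / (1 + (norm (frequency L k))\<^sup>2)\<^sup>2 \<le> (\<Prod>i\<in>UNIV. d (k $ i))" for k
  proof -
    let ?s = "1 + (norm (frequency L k))\<^sup>2"
    have s: "1 \<le> ?s" by simp
    have "(norm (frequency L k))\<^sup>2 = (c * of_int (k $ 1))\<^sup>2 + (c * of_int (k $ 2))\<^sup>2 + (c * of_int (k $ 3))\<^sup>2"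
      by (simp add: norm_real3 frequency_nth c_def)
    then have comp: "(c * of_int (k $ i))\<^sup>2 \<le> (norm (frequency L k))\<^sup>2" for i
      using exhaust_3[of i] by (elim disjE) simp_all
    have "?s powr (-2/3) \<le> d (k $ i)" for i
    proof -
      have "0 < 1 + (c * of_int (k $ i))\<^sup>2" by (rule add_pos_nonneg) simp_all
      then show ?thesis
        unfolding d using comp[of i] by (intro powr_mono2') simp_all
    qed
    then have "(\<Prod>i\<in>(UNIV :: 3 set). ?s powr (-2/3)) \<le> (\<Prod>i\<in>UNIV. d (k $ i))"
      by (intro prod_mono) auto
    moreover have "(\<Prod>i\<in>(UNIV :: 3 set). t powr (-2/3)) = 1 / t\<^sup>2" if "1 \<le> t" for t :: real
    proof -
      have "(\<Prod>i\<in>(UNIV :: 3 set). t powr (-2/3)) = t powr (-2)"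
        using powr_power[of t "-2/3" 3] that by simp
      then show ?thesis using powr_neg_numeral[of t "num.Bit0 num.One"] that by simp
    qed
    ultimately show ?thesis using s by metis
  qed
  have bound: "(\<Sum>k\<in>F. 1 / (1 + (norm (frequency L k))\<^sup>2)\<^sup>2) \<le> (2 * suminf b) ^ 3" if F: "finite F" for F
  proof -
    define I where "I = (\<Union>i. (\<lambda>k. k $ i) ` F)"
    have I: "finite I" unfolding I_def using F by auto
    have inj: "inj_on vec_nth F" by (auto simp: inj_on_def vec_nth_inject)
    have "(\<Sum>k\<in>F. 1 / (1 + (norm (frequency L k))\<^sup>2)\<^sup>2) \<le> (\<Sum>k\<in>F. \<Prod>i\<in>UNIV. d (k $ i))"
      by (intro sum_mono le)
    also have "\<dots> = (\<Sum>f\<in>vec_nth ` F. \<Prod>i\<in>UNIV. d (f i))"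
      by (simp add: sum.reindex[OF inj])
    also have "\<dots> \<le> (\<Sum>f\<in>PiE (UNIV :: 3 set) (\<lambda>_. I). \<Prod>i\<in>UNIV. d (f i))"
      using I b0 by (intro sum_mono2) (auto simp: I_def d_def intro!: finite_PiE prod_nonneg)
    also have "\<dots> = (\<Prod>i\<in>(UNIV :: 3 set). \<Sum>n\<in>I. d n)"
      using I by (simp add: prod_sum_PiE[of UNIV "\<lambda>_. I" "\<lambda>_. d"] del: prod_constant)
    also have "\<dots> = (\<Sum>n\<in>I. d n) ^ 3" by simp
    also have "\<dots> \<le> (2 * suminf b) ^ 3"
    proof (rule power_mono)
      show "(\<Sum>n\<in>I. d n) \<le> 2 * suminf b"
        unfolding d_def by (rule sum_int_abs_le[OF \<open>summable b\<close> b0 I])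
      show "0 \<le> (\<Sum>n\<in>I. d n)" unfolding d_def by (intro sum_nonneg b0)
    qed
    finally show ?thesis .
  qed
  show ?thesis
    by (rule nonneg_bdd_above_summable_on) (use bound in \<open>auto intro!: bdd_aboveI2\<close>)
qed

lemma frequency_norm_lower:
  assumes "k \<noteq> 0"
  shows "2 * pi / of_int L \<le> norm (frequency L k)"
proof -
  obtain i where i: "k $ i \<noteq> 0" using assms by (auto simp: vec_eq_iff)
  then have "1 \<le> \<bar>k $ i\<bar>" by linarith
  then have "1 \<le> real_of_int \<bar>k $ i\<bar>" by linarith
  then have "2 * pi / of_int L * 1 \<le> 2 * pi / of_int L * real_of_int \<bar>k $ i\<bar>"
    using L_pos by (intro mult_left_mono) auto
  also have "\<dots> = \<bar>frequency L k $ i\<bar>"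
    using L_pos by (simp add: frequency_nth abs_mult)
  also have "\<dots> \<le> norm (frequency L k)" by (rule component_le_norm_cart)
  finally show ?thesis by simp
qed

lemma fc_uminus_freq: "fc f (- k) = cnj (fc f k)"
proof -
  have "cnj (fc f k) = (\<integral>x. cnj (wave (- k) x * of_real (f x)) \<partial>tor)"
    unfolding fc_def by (rule Bochner_Integration.integral_cnj[symmetric])
  then show ?thesis by (simp add: fc_def cnj_wave)
qed

text \<open>The coefficients of the solution are \<open>a k = fc g k / (norm \<xi>)\<^sup>2\<close>.  By \<open>x y \<le> x\<^sup>2 + y\<^sup>2\<close> they are
  dominated, up to a constant factor, by the sum of \<open>\<bar>fc g k\<bar>\<^sup>2\<close> and \<open>1 / (1 + (norm \<xi>)\<^sup>2)\<^sup>2\<close>, both summable, so the Fourier series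
  converges absolutely to a bounded function.  This is where the dimension \<open>3 < 4\<close> enters.\<close>

lemma Poisson_bounded:
  assumes g: "L1_per L g" and g2: "integrable tor (\<lambda>x. (g x)\<^sup>2)" and mean0: "(\<integral>x. g x \<partial>tor) = 0"
  obtains \<psi> B where "per \<psi>" "\<psi> \<in> borel_measurable borel" "\<And>x. \<bar>\<psi> x\<bar> \<le> B"
    "weak_laplacian L \<psi> (\<lambda>x. - g x)"
proof -
  let ?s = "\<lambda>k. (norm (frequency L k))\<^sup>2"
  \<comment> \<open>Division by zero makes \<open>a 0 = 0\<close>, in agreement with \<open>fc g 0 = 0\<close>.\<close>
  define a where "a k = fc g k / of_real (?s k)" for k
  define C where "C = 1 + 1 / (2 * pi / of_int L)\<^sup>2"
  have g0: "fc g 0 = 0"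
    using mean0 by (simp add: fc_def)
  have a_s: "of_real (?s k) * a k = fc g k" for k
  proof (cases "k = 0")
    case False
    then have "0 < norm (frequency L k)"
      by (intro less_le_trans[OF _ frequency_norm_lower]) (use L_pos in auto)
    then have "complex_of_real (?s k) \<noteq> 0" by simp
    then show ?thesis unfolding a_def by (metis nonzero_mult_div_cancel_left times_divide_eq_right)
  qed (simp add: g0)
  have a_le: "cmod (a k) \<le> C * ((cmod (fc g k))\<^sup>2 + 1 / (1 + ?s k)\<^sup>2)" for k
  proof (cases "k = 0")
    case True
    then show ?thesis by (simp add: a_def C_def)
  next
    case False
    let ?c = "2 * pi / of_int L"
    have c: "0 < ?c" using L_pos by simp
    have "?c\<^sup>2 \<le> ?s k" using frequency_norm_lower[OF False] c by (intro power_mono) auto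
    from inverse_le_shifted[OF c this] have "1 / ?s k \<le> C / (1 + ?s k)"
      by (simp only: C_def)
    then have "cmod (fc g k) * (1 / ?s k) \<le> cmod (fc g k) * (C / (1 + ?s k))"
      by (intro mult_left_mono) auto
    then have "cmod (a k) \<le> C * (cmod (fc g k) * (1 / (1 + ?s k)))"
      by (simp add: a_def norm_divide norm_power mult_ac)
    also have "\<dots> \<le> C * ((cmod (fc g k))\<^sup>2 + (1 / (1 + ?s k))\<^sup>2)"
    proof (rule mult_left_mono)
      show "x * y \<le> x\<^sup>2 + y\<^sup>2" for x y :: real
        using sum_squares_bound[of x y] zero_le_power2[of x] zero_le_power2[of y] by linarith
    qed (simp add: C_def)
    finally show ?thesis by (simp add: power_divide)
  qed
  have "(\<lambda>k. C * ((cmod (fc g k))\<^sup>2 + 1 / (1 + ?s k)\<^sup>2)) summable_on UNIV"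
    by (intro summable_on_cmult_right summable_on_add Bessel L1_perD(3) g g2 lattice_summable)
  then have "(\<lambda>k. cmod (a k)) summable_on UNIV"
    by (rule summable_on_comparison_test) (use a_le in auto)
  then have "(\<lambda>n. cmod (a (enum n))) summable_on UNIV"
    using summable_on_reindex_bij_betw[OF bij_enum, of "\<lambda>k. cmod (a k)"] by simp
  then have sum: "summable (\<lambda>n. cmod (a (enum n)))"
    by (simp add: summable_on_UNIV_nonneg_real_iff)
  define S where "S x = (\<Sum>n. a (enum n) * wave (enum n) x)" for x
  define \<psi> where "\<psi> x = Re (S x)" for x
  have sumw: "summable (\<lambda>n. cmod (a (enum n) * wave (enum n) x))" for x
    using sum by (simp add: norm_mult)
  have [measurable]: "S \<in> borel_measurable borel" unfolding S_def by measurable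
  have Sb: "cmod (S x) \<le> (\<Sum>n. cmod (a (enum n)))" for x
    unfolding S_def using summable_norm[OF sumw[of x]] by (simp add: norm_mult)
  have pS: "per S" using per_wave by (simp add: per_def S_def)
  have Si: "(\<integral>x. wave (- k) x * S x \<partial>tor) = a k" for k
  proof -
    have "(\<integral>x. wave (- k) x * S x \<partial>tor) = (\<integral>x. (\<Sum>n. a (enum n) * (wave (enum n) x * wave (- k) x)) \<partial>tor)"
      unfolding S_def using summable_norm_cancel[OF sumw]
      by (subst suminf_mult[symmetric]) (simp_all add: mult_ac)
    also have "\<dots> = (\<Sum>n. \<integral>x. a (enum n) * (wave (enum n) x * wave (- k) x) \<partial>tor)"
    proof (rule integral_suminf)
      have [simp]: "integrable tor (\<lambda>x. wave (enum n) x * wave (- k) x)" for n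
        by (simp flip: wave_add)
      show "integrable tor (\<lambda>x. a (enum n) * (wave (enum n) x * wave (- k) x))" for n by simp
      show "AE x in tor. summable (\<lambda>n. norm (a (enum n) * (wave (enum n) x * wave (- k) x)))"
        using sum by (simp add: norm_mult)
      show "summable (\<lambda>n. \<integral>x. norm (a (enum n) * (wave (enum n) x * wave (- k) x)) \<partial>tor)"
        using sum tor.prob_space by (simp add: norm_mult)
    qed
    also have "\<dots> = (\<Sum>n. if enum n = k then a k else 0)"
      by (intro suminf_cong) (simp add: integral_wave_mult)
    also have "\<dots> = a k"
    proof -
      obtain n where n: "enum n = k" using bij_enum by (metis bij_pointE)
      have "enum m = k \<longleftrightarrow> m = n" for m using bij_enum n by (metis bij_pointE)
      then show ?thesis using sums_single[of n "\<lambda>_. a k"] by (simp add: sums_iff)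
    qed
    finally show ?thesis .
  qed
  have Sint: "integrable tor (\<lambda>x. wave (- k) x * S x)" "integrable tor (\<lambda>x. cnj (wave k x * S x))" for k
  proof -
    have i: "integrable tor (\<lambda>x. wave l x * S x)" for l
      by (rule integrable_tor_bounded) (use Sb in \<open>auto simp: norm_mult\<close>)
    from i[of "- k"] show "integrable tor (\<lambda>x. wave (- k) x * S x)" .
    from i[of k] show "integrable tor (\<lambda>x. cnj (wave k x * S x))" by (rule integrable_cnj)
  qed
  have \<psi>_fc: "fc \<psi> k = a k" for k
  proof -
    have eq: "wave (- k) x * of_real (\<psi> x) = (wave (- k) x * S x + cnj (wave k x * S x)) / 2" for x
      by (simp add: \<psi>_def cnj_wave complex_eq_iff algebra_simps flip: cnj_wave)
    have "fc \<psi> k = ((\<integral>x. wave (- k) x * S x \<partial>tor) + (\<integral>x. cnj (wave k x * S x) \<partial>tor)) / 2"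
      unfolding fc_def eq integral_divide_zero Bochner_Integration.integral_add[OF Sint] ..
    also have "(\<integral>x. cnj (wave k x * S x) \<partial>tor) = cnj (a (- k))"
      using Si[of "- k"] by (simp only: Bochner_Integration.integral_cnj minus_minus)
    also have "cnj (a (- k)) = a k"
      by (simp add: a_def fc_uminus_freq frequency_minus)
    finally show ?thesis by (simp add: Si)
  qed
  show ?thesis
  proof
    show p: "per \<psi>" using pS by (simp add: per_def \<psi>_def)
    show m: "\<psi> \<in> borel_measurable borel" unfolding \<psi>_def by measurable
    show b: "\<bar>\<psi> x\<bar> \<le> (\<Sum>n. cmod (a (enum n)))" for x
      unfolding \<psi>_def by (rule order_trans[OF abs_Re_le_cmod Sb])
    show "weak_laplacian L \<psi> (\<lambda>x. - g x)"
    proof (rule weak_laplacianI_fourier)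
      show "L1_per L \<psi>" by (rule L1_per_bounded[OF p m b])
      show "L1_per L (\<lambda>x. - g x)" using L1_per_cmult[OF g, of "-1"] by simp
      show "fc (\<lambda>x. - g x) k = - of_real (?s k) * fc \<psi> k" for k
        using a_s[of k] by (simp add: fc_minus \<psi>_fc)
    qed
  qed
qed

end

section \<open>The landscape function is bounded below\<close>

lemma potential_floor: "potential \<omega> x = \<omega> (\<chi> i. \<lfloor>x $ i\<rfloor>)"
proof -
  let ?J = "\<chi> i. \<lfloor>x $ i\<rfloor>"
  have "x - int_vec j \<in> unit_cell \<longleftrightarrow> j = ?J" for j
  proof -
    have "0 \<le> x $ i - of_int (j $ i) \<and> x $ i - of_int (j $ i) < 1 \<longleftrightarrow> \<lfloor>x $ i\<rfloor> = j $ i" for i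
      by (auto simp: floor_eq_iff)
    then show ?thesis
      by (auto simp: unit_cell_def int_vec_def vec_eq_iff)
  qed
  then have "potential \<omega> x = (\<Sum>\<^sub>\<infinity>j. if j = ?J then \<omega> j else 0)"
    unfolding potential_def by (intro infsum_cong) (simp add: indicator_def)
  also have "\<dots> = (\<Sum>\<^sub>\<infinity>j\<in>{?J}. \<omega> j)"
    by (rule infsum_cong_neutral) auto
  finally show ?thesis by simp
qed

lemma finite_range_potential:
  assumes "0 < L" and \<omega>: "landscape_admissible L \<omega>"
  shows "finite (range (potential \<omega>))"
proof -
  let ?F = "PiE (UNIV :: 3 set) (\<lambda>_. {0..<L})"
  have "\<omega> j \<in> (\<lambda>f. \<omega> (vec_lambda f)) ` ?F" for j
  proof
    have "\<omega> (\<chi> i. (\<chi> i. j $ i mod L) $ i + L * (\<chi> i. j $ i div L) $ i) = \<omega> (\<chi> i. j $ i mod L)"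
      using \<omega> unfolding landscape_admissible_def by blast
    then show "\<omega> j = \<omega> (vec_lambda (\<lambda>i. j $ i mod L))" by simp
    show "(\<lambda>i. j $ i mod L) \<in> ?F" using assms(1) by auto
  qed
  then have "range (potential \<omega>) \<subseteq> (\<lambda>f. \<omega> (vec_lambda f)) ` ?F"
    by (auto simp: potential_floor)
  moreover have "finite ?F" by (intro finite_PiE) auto
  ultimately show ?thesis by (meson finite_imageI finite_subset)
qed

lemma potential_bounds:
  assumes "0 < L" and "landscape_admissible L \<omega>"
  shows "Vmin \<omega> \<le> potential \<omega> x" and "potential \<omega> x \<le> Vmax \<omega>"
  using finite_range_potential[OF assms]
  by (auto simp: Vmin_def Vmax_def intro!: cINF_lower cSUP_upper bdd_below_finite bdd_above_finite)

context torus
begin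

text \<open>A weak solution is recovered from \<open>lam z - \<Delta> z\<close> by positive averaging, so that pointwise bounds on
  \<open>lam z - \<Delta> z\<close> pass to \<open>z\<close>.\<close>

lemma resolvent_inverts:
  assumes lam: "0 < lam" and w: "weak_laplacian L z D"
  shows "AE x in tor. resolvent lam (\<lambda>x. lam * z x - D x) x = z x"
proof -
  have z: "L1_per L z" and D: "L1_per L D" using w by (auto simp: weak_laplacian_def)
  have h: "L1_per L (\<lambda>x. lam * z x - D x)" by (intro L1_per_diff L1_per_cmult z D)
  have "fc (resolvent lam (\<lambda>x. lam * z x - D x)) k = fc z k" for k
  proof -
    let ?s = "(norm (frequency L k))\<^sup>2"
    have "complex_of_real (lam + ?s) \<noteq> 0"
      using lam by (metis add_pos_nonneg less_irrefl of_real_eq_0_iff zero_le_power2)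
    moreover have "fc (\<lambda>x. lam * z x - D x) k = of_real (lam + ?s) * fc z k"
      using L1_perD(3)[OF L1_per_cmult[OF z]] L1_perD(3)[OF D]
      by (simp add: fc_diff fc_cmult weak_laplacian_fourier[OF w] algebra_simps)
    ultimately show ?thesis
      unfolding fc_resolvent[OF lam h] by (metis nonzero_mult_div_cancel_left)
  qed
  then show ?thesis
    by (intro fourier_unique L1_perD(3)[OF resolvent_L1[OF lam h]] L1_perD(3)[OF z])
qed

lemma weak_laplacian_diff_const:
  assumes w: "weak_laplacian L u D"
  shows "weak_laplacian L (\<lambda>x. u x - c) D"
proof (rule weak_laplacianI_fourier)
  have u: "L1_per L u" and D: "L1_per L D" using w by (auto simp: weak_laplacian_def)
  show "L1_per L D" by (rule D)
  show "L1_per L (\<lambda>x. u x - c)" by (intro L1_per_diff u L1_per_const)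
  have "of_real ((norm (frequency L k))\<^sup>2) * fc (\<lambda>x. c) k = 0" for k
    by (simp add: fc_const)
  then show "fc D k = - of_real ((norm (frequency L k))\<^sup>2) * fc (\<lambda>x. u x - c) k" for k
    using L1_perD(3)[OF u] L1_perD(3)[OF L1_per_const[of c]]
    by (simp add: fc_diff weak_laplacian_fourier[OF w] right_diff_distrib)
qed

text \<open>The minimum principle in \<open>L\<^sup>1\<close>.  The constant \<open>1 / a\<^sub>1\<close> is a subsolution of the landscape
  equation.  For \<open>z = u - 1 / a\<^sub>1\<close> and \<open>lam = a\<^sub>1 / \<epsilon>\<^sup>2\<close> the equation makes \<open>z\<close> the resolvent of a
  function that is at least \<open>- c m\<close>, where \<open>m\<close> is the negative part of \<open>z\<close> and
  \<open>c = (a\<^sub>1 - a\<^sub>0) / \<epsilon>\<^sup>2 < lam\<close>.  So \<open>m\<close> is at most \<open>c\<close> times its own resolvent; the integral of the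
  latter is \<open>c / lam < 1\<close> times the integral of \<open>m\<close>, hence \<open>m = 0\<close> almost everywhere.\<close>

lemma landscape_lower_bound:
  assumes eps: "0 < \<epsilon>" and a0: "0 < a\<^sub>0"
    and lo: "\<And>x. a\<^sub>0 \<le> V x - Vcut" and hi: "\<And>x. V x - Vcut \<le> a\<^sub>1"
    and u: "landscape_function L \<epsilon> V Vcut u"
  shows "AE x in tor. 1 / a\<^sub>1 \<le> u x"
proof -
  obtain D where w: "weak_laplacian L u D"
    and eq: "AE x in lborel. - \<epsilon>\<^sup>2 * D x + (V x - Vcut) * u x = 1"
    using u by (auto simp: landscape_function_def)
  have a01: "a\<^sub>0 \<le> a\<^sub>1" using lo[of 0] hi[of 0] by simp
  then have a1: "0 < a\<^sub>1" using a0 by simp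
  define lam where "lam = a\<^sub>1 / \<epsilon>\<^sup>2"
  define c where "c = (a\<^sub>1 - a\<^sub>0) / \<epsilon>\<^sup>2"
  have lam: "0 < lam" using eps a1 by (simp add: lam_def)
  have c: "0 \<le> c" "c < lam" using a01 a0 eps by (simp_all add: c_def lam_def divide_strict_right_mono)
  define z where "z x = u x - 1 / a\<^sub>1" for x
  define m where "m x = max 0 (- z x)" for x
  define h where "h x = lam * z x - D x" for x
  have wz: "weak_laplacian L z D" unfolding z_def by (rule weak_laplacian_diff_const[OF w])
  then have z: "L1_per L z" and D: "L1_per L D" by (auto simp: weak_laplacian_def)
  have [measurable]: "z \<in> borel_measurable borel" by (rule L1_perD(2)[OF z])
  have h: "L1_per L h" unfolding h_def by (intro L1_per_diff L1_per_cmult z D)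
  have m: "L1_per L m"
    using L1_perD[OF z] unfolding m_def by (intro L1_perI) (auto simp: per_def)
  have cm: "L1_per L (\<lambda>x. - c * m x)" by (rule L1_per_cmult[OF m])
  have m0: "0 \<le> m x" for x by (simp add: m_def)
  have "AE x in tor. - c * m x \<le> h x"
    using AE_lborel_imp_tor[OF eq]
  proof eventually_elim
    case (elim x)
    let ?a = "V x - Vcut"
    have De: "D x * \<epsilon>\<^sup>2 = ?a * u x - 1"
      using elim by (simp add: mult.commute[of "D x"])
    have "u x = z x + 1 / a\<^sub>1" by (simp add: z_def)
    then have "(a\<^sub>1 - ?a) * z x + (1 - ?a / a\<^sub>1) = a\<^sub>1 * z x - D x * \<epsilon>\<^sup>2"
      unfolding De by (simp add: distrib_left left_diff_distrib)
    moreover have "h x = (a\<^sub>1 * z x - D x * \<epsilon>\<^sup>2) / \<epsilon>\<^sup>2"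
      using eps by (simp add: h_def lam_def diff_divide_distrib)
    ultimately have "h x = ((a\<^sub>1 - ?a) * z x + (1 - ?a / a\<^sub>1)) / \<epsilon>\<^sup>2"
      by simp
    moreover have "- ((a\<^sub>1 - a\<^sub>0) * m x) \<le> (a\<^sub>1 - ?a) * z x + (1 - ?a / a\<^sub>1)"
    proof -
      have "(a\<^sub>1 - ?a) * (- z x) \<le> (a\<^sub>1 - ?a) * m x"
        using hi[of x] by (intro mult_left_mono) (auto simp: m_def)
      also have "\<dots> \<le> (a\<^sub>1 - a\<^sub>0) * m x"
        using lo[of x] m0 by (intro mult_right_mono) auto
      finally have "- ((a\<^sub>1 - a\<^sub>0) * m x) \<le> (a\<^sub>1 - ?a) * z x" by simp
      moreover have "?a / a\<^sub>1 \<le> 1" using hi[of x] a1 by simp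
      ultimately show ?thesis by linarith
    qed
    ultimately have "- ((a\<^sub>1 - a\<^sub>0) * m x) / \<epsilon>\<^sup>2 \<le> h x"
      by (simp only:) (rule divide_right_mono, simp_all)
    then show ?case by (simp add: c_def)
  qed
  then have "AE x in tor. resolvent lam (\<lambda>x. - c * m x) x \<le> resolvent lam h x"
    by (rule resolvent_mono_AE[OF lam cm h])
  moreover have "AE x in tor. resolvent lam h x = z x"
    using resolvent_inverts[OF lam wz] by (simp add: h_def[abs_def])
  moreover have "AE x in tor. resolvent lam (\<lambda>x. - c * m x) x \<le> resolvent lam (\<lambda>x. 0) x"
    using c m0 by (intro resolvent_mono_AE[OF lam cm L1_per_const]) simp
  ultimately have "AE x in tor. m x \<le> - resolvent lam (\<lambda>x. - c * m x) x"
    by eventually_elim (simp add: m_def resolvent_const[OF lam])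
  then have "(\<integral>x. m x \<partial>tor) \<le> (\<integral>x. - resolvent lam (\<lambda>x. - c * m x) x \<partial>tor)"
    using L1_perD(3)[OF m] L1_perD(3)[OF resolvent_L1[OF lam cm]] by (intro integral_mono_AE) auto
  also have "\<dots> = c / lam * (\<integral>x. m x \<partial>tor)"
    by (simp only: integral_minus integral_resolvent[OF lam cm] integral_mult_right_zero) simp
  finally have "(1 - c / lam) * (\<integral>x. m x \<partial>tor) \<le> 0" by (simp add: algebra_simps)
  moreover have "0 < 1 - c / lam" using c lam by simp
  ultimately have "(\<integral>x. m x \<partial>tor) \<le> 0" by (simp add: mult_le_0_iff)
  moreover have "0 \<le> (\<integral>x. m x \<partial>tor)" using m0 by (intro integral_nonneg_AE) auto
  ultimately have "(\<integral>x. m x \<partial>tor) = 0" by simp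
  then have "AE x in tor. m x = 0"
    using integral_nonneg_eq_0_iff_AE[OF L1_perD(3)[OF m]] m0 by simp
  then show ?thesis by eventually_elim (simp add: m_def z_def)
qed

end

section \<open>The Fermi-Dirac density\<close>

text \<open>The value of \<^const>\<open>F_LSC\<close> at a point as a function of the local chemical potential
  \<open>s = \<phi> + \<mu> - 1 / u - Vcut\<close> there.\<close>

definition fermi_density :: "real \<Rightarrow> real \<Rightarrow> real \<Rightarrow> real" where
  "fermi_density \<epsilon> \<beta> s = 1 / (2 * pi * \<epsilon>) ^ 3 *
     (LINT p|(lborel :: (real^3) measure). f_FD (\<beta> * ((norm p)\<^sup>2 - s)))"

lemma F_LSC_eq: "F_LSC \<epsilon> \<beta> Vcut u \<phi> \<mu> x = fermi_density \<epsilon> \<beta> (\<phi> x + \<mu> - 1 / u x - Vcut)"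
proof -
  have "(norm p)\<^sup>2 + 1 / u x - \<phi> x + Vcut - \<mu> = (norm p)\<^sup>2 - (\<phi> x + \<mu> - 1 / u x - Vcut)" for p :: "real^3"
    by simp
  then show ?thesis unfolding F_LSC_def fermi_density_def by (simp only:)
qed

lemma integrable_gaussian:
  assumes "0 < \<beta>"
  shows "integrable lborel (\<lambda>p :: 'a :: euclidean_space. exp (- \<beta> * (norm p)\<^sup>2))"
proof (rule integrableI_bounded)
  define \<sigma> where "\<sigma> = 1 / sqrt (2 * \<beta>)"
  have \<sigma>: "0 < \<sigma>" "2 * \<sigma>\<^sup>2 = 1 / \<beta>" using assms by (simp_all add: \<sigma>_def power_divide)
  have "integrable lborel (\<lambda>t. sqrt (2 * pi * \<sigma>\<^sup>2) * normal_density 0 \<sigma> t)"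
    using \<sigma> by simp
  moreover have "sqrt (2 * pi * \<sigma>\<^sup>2) * normal_density 0 \<sigma> t = exp (- \<beta> * t\<^sup>2)" for t
    using \<sigma> by (simp add: normal_density_def)
  ultimately have "integrable lborel (\<lambda>t::real. exp (- \<beta> * t\<^sup>2))" by simp
  then have fin: "(\<integral>\<^sup>+t. ennreal (exp (- \<beta> * t\<^sup>2)) \<partial>lborel) < \<infinity>"
    by (simp add: integrable_iff_bounded)
  have "ennreal (norm (exp (- \<beta> * (norm p)\<^sup>2))) = (\<Prod>b\<in>Basis. ennreal (exp (- \<beta> * (p \<bullet> b)\<^sup>2)))" for p :: 'a
  proof -
    have "(norm p)\<^sup>2 = (\<Sum>b\<in>Basis. (p \<bullet> b)\<^sup>2)"
      unfolding power2_norm_eq_inner by (subst euclidean_inner) (simp add: power2_eq_square)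
    then show ?thesis by (simp add: prod_ennreal exp_sum sum_distrib_left abs_prod flip: sum_negf)
  qed
  then have "(\<integral>\<^sup>+p. ennreal (norm (exp (- \<beta> * (norm p)\<^sup>2))) \<partial>(lborel :: 'a measure))
     = (\<Prod>b\<in>(Basis :: 'a set). \<integral>\<^sup>+t. ennreal (exp (- \<beta> * t\<^sup>2)) \<partial>lborel)"
    by (simp only:) (rule nn_integral_lborel_prod; simp)
  also have "\<dots> < \<infinity>" using fin by (simp add: ennreal_prod_eq_top power_less_top_ennreal)
  finally show "(\<integral>\<^sup>+p. ennreal (norm (exp (- \<beta> * (norm p)\<^sup>2))) \<partial>(lborel :: 'a measure)) < \<infinity>" .
qed measurable

lemma f_FD_nonneg: "0 \<le> f_FD t"
  by (simp add: f_FD_def add_nonneg_nonneg)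

lemma f_FD_le_exp: "f_FD t \<le> exp (- t)"
  by (simp add: f_FD_def exp_minus divide_simps add_pos_pos)

lemma f_FD_half: "t \<le> 0 \<Longrightarrow> 1 / 2 \<le> f_FD t"
  using exp_le_one_iff[of t] by (simp add: f_FD_def divide_simps add_pos_pos)

text \<open>With \<open>A = exp t\<close> and \<open>B = exp t'\<close> the upper bound is
  \<open>1 / (1 + A) - 1 / (1 + B) \<le> 1 / A - 1 / B\<close>.  It bounds increments of the density by Gaussian
  integrals.\<close>

lemma f_FD_diff:
  assumes "t \<le> t'"
  shows "0 \<le> f_FD t - f_FD t'" "f_FD t - f_FD t' \<le> exp (- t) - exp (- t')"
proof -
  define A B where "A = exp t" and "B = exp t'"
  have AB: "0 < A" "A \<le> B" "0 < B" using assms by (auto simp: A_def B_def)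
  have 1: "f_FD t - f_FD t' = (B - A) / ((1 + A) * (1 + B))"
    using AB by (simp add: f_FD_def A_def[symmetric] B_def[symmetric] divide_simps add_pos_pos)
  have 2: "exp (- t) - exp (- t') = (B - A) / (A * B)"
    using AB by (simp add: exp_minus A_def[symmetric] B_def[symmetric] divide_simps)
  show "0 \<le> f_FD t - f_FD t'" unfolding 1 using AB by simp
  show "f_FD t - f_FD t' \<le> exp (- t) - exp (- t')"
    unfolding 1 2 using AB by (intro divide_left_mono mult_mono) auto
qed

lemma borel_f_FD [measurable]: "f_FD \<in> borel_measurable borel"
proof -
  have "continuous_on UNIV f_FD"
    unfolding f_FD_def[abs_def] by (intro continuous_intros) (smt (verit) exp_gt_zero)
  then show ?thesis by (rule borel_measurable_continuous_onI)
qed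

context
  fixes \<epsilon> \<beta> :: real
  assumes eps: "0 < \<epsilon>" and beta: "0 < \<beta>"
begin

abbreviation (input) "G \<equiv> fermi_density \<epsilon> \<beta>"

text \<open>The density of the Boltzmann distribution \<open>exp (- t)\<close> in place of \<^const>\<open>f_FD\<close>, at \<open>s = 0\<close>.\<close>

definition "gauss_const = 1 / (2 * pi * \<epsilon>) ^ 3 * (\<integral>p. exp (- \<beta> * (norm (p::real^3))\<^sup>2) \<partial>lborel)"

lemma integrable_exp_shift: "integrable lborel (\<lambda>p::real^3. exp (- (\<beta> * ((norm p)\<^sup>2 - s))))"
proof -
  have "exp (- (\<beta> * ((norm p)\<^sup>2 - s))) = exp (\<beta> * s) * exp (- \<beta> * (norm p)\<^sup>2)" for p :: "real^3"
    by (simp add: algebra_simps flip: exp_add)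
  then show ?thesis using integrable_gaussian[OF beta] by simp
qed

lemma integral_exp_shift:
  "1 / (2 * pi * \<epsilon>) ^ 3 * (\<integral>p. exp (- (\<beta> * ((norm (p::real^3))\<^sup>2 - s))) \<partial>lborel) = gauss_const * exp (\<beta> * s)"
proof -
  have "exp (- (\<beta> * ((norm p)\<^sup>2 - s))) = exp (\<beta> * s) * exp (- \<beta> * (norm p)\<^sup>2)" for p :: "real^3"
    by (simp add: algebra_simps flip: exp_add)
  then show ?thesis by (simp add: gauss_const_def)
qed

lemma integrable_f_FD: "integrable lborel (\<lambda>p::real^3. f_FD (\<beta> * ((norm p)\<^sup>2 - s)))"
  by (rule Bochner_Integration.integrable_bound[OF integrable_exp_shift])
     (auto simp: f_FD_nonneg intro!: f_FD_le_exp)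

lemma const_pos: "0 < 1 / (2 * pi * \<epsilon>) ^ 3"
  using eps by simp

lemma gauss_const_nonneg: "0 \<le> gauss_const"
  unfolding gauss_const_def using const_pos by (intro mult_nonneg_nonneg) auto

lemma fermi_density_diff:
  assumes "s \<le> t"
  shows "G s \<le> G t" and "G t - G s \<le> gauss_const * (exp (\<beta> * t) - exp (\<beta> * s))"
proof -
  have le: "\<beta> * ((norm p)\<^sup>2 - t) \<le> \<beta> * ((norm p)\<^sup>2 - s)" for p :: "real^3"
    using assms beta by (intro mult_left_mono) auto
  show "G s \<le> G t"
    unfolding fermi_density_def using f_FD_diff(1)[OF le] const_pos
    by (intro mult_left_mono integral_mono integrable_f_FD) (auto simp: less_imp_le)
  have "G t - G s = 1 / (2 * pi * \<epsilon>) ^ 3 *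
      (\<integral>p. f_FD (\<beta> * ((norm (p::real^3))\<^sup>2 - t)) - f_FD (\<beta> * ((norm p)\<^sup>2 - s)) \<partial>lborel)"
    unfolding fermi_density_def Bochner_Integration.integral_diff[OF integrable_f_FD integrable_f_FD]
    by (simp only: right_diff_distrib)
  also have "\<dots> \<le> 1 / (2 * pi * \<epsilon>) ^ 3 *
      (\<integral>p. exp (- (\<beta> * ((norm (p::real^3))\<^sup>2 - t))) - exp (- (\<beta> * ((norm p)\<^sup>2 - s))) \<partial>lborel)"
    using f_FD_diff(2)[OF le] less_imp_le[OF const_pos]
    by (intro mult_left_mono integral_mono Bochner_Integration.integrable_diff integrable_f_FD integrable_exp_shift)
  also have "\<dots> = gauss_const * (exp (\<beta> * t) - exp (\<beta> * s))"
    unfolding Bochner_Integration.integral_diff[OF integrable_exp_shift integrable_exp_shift]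
    by (simp only: right_diff_distrib[of "1 / (2 * pi * \<epsilon>) ^ 3"] right_diff_distrib[of gauss_const] integral_exp_shift)
  finally show "G t - G s \<le> gauss_const * (exp (\<beta> * t) - exp (\<beta> * s))" .
qed

lemma fermi_density_mono: "mono G"
  by (rule monoI) (rule fermi_density_diff)

text \<open>Convexity of the exponential turns the bound on increments into a Lipschitz bound on every
  half-line that is bounded above.\<close>

lemma fermi_density_lipschitz:
  "\<exists>\<Lambda>. \<forall>s t. s \<le> t \<longrightarrow> t \<le> S \<longrightarrow> G t - G s \<le> \<Lambda> * (t - s)"
proof (intro exI allI impI)
  fix s t assume st: "s \<le> t" "t \<le> S"
  have "1 + \<beta> * (s - t) \<le> exp (\<beta> * (s - t))" by (rule exp_ge_add_one_self)
  then have "exp (\<beta> * t) * (1 + \<beta> * (s - t)) \<le> exp (\<beta> * t) * exp (\<beta> * (s - t))"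
    by (rule mult_left_mono) simp
  also have "\<dots> = exp (\<beta> * s)" by (simp add: algebra_simps flip: exp_add)
  finally have "exp (\<beta> * t) - exp (\<beta> * s) \<le> exp (\<beta> * t) * (\<beta> * (t - s))"
    by (simp add: algebra_simps)
  also have "\<dots> \<le> exp (\<beta> * S) * (\<beta> * (t - s))"
    using st beta by (intro mult_right_mono) auto
  finally have "gauss_const * (exp (\<beta> * t) - exp (\<beta> * s)) \<le> gauss_const * (exp (\<beta> * S) * (\<beta> * (t - s)))"
    using gauss_const_nonneg by (rule mult_left_mono)
  then show "G t - G s \<le> (gauss_const * exp (\<beta> * S) * \<beta>) * (t - s)"
    using fermi_density_diff(2)[OF st(1)] by (simp add: mult.assoc)
qed

lemma fermi_density_small:
  assumes "0 < y"
  shows "\<exists>s. G s \<le> y"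
proof -
  have "G s \<le> gauss_const * exp (\<beta> * s)" for s
  proof -
    have "G s \<le> 1 / (2 * pi * \<epsilon>) ^ 3 * (\<integral>p. exp (- (\<beta> * ((norm (p::real^3))\<^sup>2 - s))) \<partial>lborel)"
      unfolding fermi_density_def using less_imp_le[OF const_pos]
      by (intro mult_left_mono integral_mono integrable_f_FD integrable_exp_shift f_FD_le_exp)
    then show ?thesis by (simp only: integral_exp_shift)
  qed
  \<comment> \<open>The summand \<open>1\<close> keeps the quotient meaningful without knowing that the constant is positive.\<close>
  moreover have "gauss_const * exp (\<beta> * (ln (y / (gauss_const + 1)) / \<beta>)) \<le> y"
    using gauss_const_nonneg assms beta by (simp add: field_simps add_nonneg_pos)
  ultimately show ?thesis by (meson order_trans)
qed

text \<open>On a cube of side \<open>c\<close> at the origin the integrand is at least \<open>1 / 2\<close> once \<open>s = 3 c\<^sup>2\<close>.\<close>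

lemma fermi_density_large: "\<exists>s. y \<le> G s"
proof -
  have low: "1 / (2 * pi * \<epsilon>) ^ 3 * (c ^ 3 / 2) \<le> G (3 * c\<^sup>2)" if c: "0 \<le> c" for c
  proof -
    define Q :: "(real^3) set" where "Q = cbox 0 (\<chi> i. c)"
    have "emeasure lborel Q = ennreal (\<Prod>b\<in>(Basis :: (real^3) set). ((\<chi> i. c) - 0) \<bullet> b)"
      unfolding Q_def using c by (intro emeasure_lborel_cbox) (auto simp: Basis_vec_def inner_axis)
    also have "(\<Prod>b\<in>(Basis :: (real^3) set). ((\<chi> i. c) - 0) \<bullet> b) = (\<Prod>b\<in>(Basis :: (real^3) set). c)"
      by (intro prod.cong) (auto simp: Basis_vec_def inner_axis)
    finally have em: "emeasure lborel Q = ennreal (c ^ 3)" by simp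
    then have mQ: "measure lborel Q = c ^ 3" using c by (simp add: measure_def)
    have Qi: "integrable lborel (\<lambda>p. indicator Q p / 2 :: real)"
      using em by (intro integrable_divide integrable_real_indicator) (auto simp: Q_def)
    have "c ^ 3 / 2 = (\<integral>p. indicator Q p / 2 \<partial>lborel)"
      using mQ by simp
    also have "\<dots> \<le> (\<integral>p. f_FD (\<beta> * ((norm (p::real^3))\<^sup>2 - 3 * c\<^sup>2)) \<partial>lborel)"
    proof (rule integral_mono[OF Qi integrable_f_FD])
      fix p :: "real^3"
      show "indicator Q p / 2 \<le> f_FD (\<beta> * ((norm p)\<^sup>2 - 3 * c\<^sup>2))"
      proof (cases "p \<in> Q")
        case True
        then have "(p $ i)\<^sup>2 \<le> c\<^sup>2" for i
          by (intro power_mono) (auto simp: Q_def mem_box_cart)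
        from this[of 1] this[of 2] this[of 3] have "(norm p)\<^sup>2 \<le> 3 * c\<^sup>2" by (simp add: norm_real3)
        then have "\<beta> * ((norm p)\<^sup>2 - 3 * c\<^sup>2) \<le> 0" using beta by (simp add: mult_le_0_iff)
        then show ?thesis using f_FD_half True by simp
      qed (simp add: f_FD_nonneg)
    qed
    finally show ?thesis
      unfolding fermi_density_def by (rule mult_left_mono) (use const_pos in simp)
  qed
  \<comment> \<open>As \<open>c \<ge> 1\<close>, the volume \<open>c ^ 3\<close> is at least \<open>c\<close>, which is chosen linearly in \<open>y\<close>.\<close>
  define c where "c = max 1 (2 * \<bar>y\<bar> * (2 * pi * \<epsilon>) ^ 3)"
  have c: "1 \<le> c" by (simp add: c_def)
  have "y \<le> 1 / (2 * pi * \<epsilon>) ^ 3 * (2 * \<bar>y\<bar> * (2 * pi * \<epsilon>) ^ 3 / 2)"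
    using eps by simp
  also have "\<dots> \<le> 1 / (2 * pi * \<epsilon>) ^ 3 * (c / 2)"
    using const_pos by (intro mult_left_mono divide_right_mono) (auto simp: c_def)
  also have "\<dots> \<le> 1 / (2 * pi * \<epsilon>) ^ 3 * (c ^ 3 / 2)"
    using const_pos c self_le_power[of c 3] by (intro mult_left_mono divide_right_mono) auto
  also have "\<dots> \<le> G (3 * c\<^sup>2)" using c by (intro low) simp
  finally show ?thesis by blast
qed

lemma fermi_density_continuous: "isCont G s"
proof -
  have bound: "\<bar>G t - G s\<bar> \<le> gauss_const * \<bar>exp (\<beta> * t) - exp (\<beta> * s)\<bar>" for t
    using fermi_density_diff[of s t] fermi_density_diff[of t s] beta by (cases "s \<le> t") auto
  have "isCont (\<lambda>t. gauss_const * \<bar>exp (\<beta> * t) - exp (\<beta> * s)\<bar>) s"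
    by (intro continuous_intros)
  then have "((\<lambda>t. gauss_const * \<bar>exp (\<beta> * t) - exp (\<beta> * s)\<bar>) \<longlongrightarrow> 0) (at s)"
    by (simp add: isCont_def)
  then have "((\<lambda>t. G t - G s) \<longlongrightarrow> 0) (at s)"
    by (rule Lim_null_comparison[rotated]) (simp add: bound)
  then show ?thesis by (simp add: isCont_def LIM_zero_iff)
qed

end

context torus
begin

section \<open>Monotone iteration\<close>

text \<open>Since \<open>b\<close> is bounded, constants \<open>m \<le> K\<close> far enough apart are a subsolution and a supersolution
  of \<open>- \<Delta> v + G (v + b) = \<kappa>\<^sub>0\<close>.  The equation is the fixed point equation of
  \<open>f \<mapsto> (lam - \<Delta>)\<^sup>-\<^sup>1 (lam f + \<kappa>\<^sub>0 - G (f + b))\<close>.  If \<open>lam\<close> is at least the Lipschitz constant of \<open>G\<close> on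
  the relevant range, this map is monotone; so its iterates from \<open>K\<close> decrease and stay above \<open>m\<close>.
  By dominated convergence their pointwise limit is a fixed point.\<close>

lemma monotone_iteration:
  fixes G :: "real \<Rightarrow> real"
  assumes per_b: "per b" and b_borel [measurable]: "b \<in> borel_measurable borel" and bB: "\<And>x. \<bar>b x\<bar> \<le> B"
    and G_mono: "mono G" and G_cont: "\<And>s. isCont G s"
    and G_lip: "\<And>S. \<exists>\<Lambda>. \<forall>s t. s \<le> t \<longrightarrow> t \<le> S \<longrightarrow> G t - G s \<le> \<Lambda> * (t - s)"
    and s0: "G s0 \<le> \<kappa>\<^sub>0" and s1: "\<kappa>\<^sub>0 \<le> G s1"
  obtains v C where "per v" "v \<in> borel_measurable borel" "\<And>x. \<bar>v x\<bar> \<le> C"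
    "weak_laplacian L v (\<lambda>x. G (v x + b x) - \<kappa>\<^sub>0)"
proof -
  have Gle: "s \<le> t \<Longrightarrow> G s \<le> G t" for s t using G_mono by (rule monoD)
  have [measurable]: "G \<in> borel_measurable borel"
    using G_cont by (intro borel_measurable_continuous_onI) (simp add: continuous_at_imp_continuous_on)
  define K where "K = max s0 s1 + B"
  define m where "m = min s0 s1 - B"
  have B0: "0 \<le> B" using bB[of 0] by linarith
  have mK: "m \<le> K" using B0 by (simp add: m_def K_def)
  have GK: "\<kappa>\<^sub>0 \<le> G (K + b x)" for x
    using bB[of x] by (intro order_trans[OF s1 Gle]) (auto simp: K_def)
  have Gm: "G (m + b x) \<le> \<kappa>\<^sub>0" for x
    using bB[of x] by (intro order_trans[OF Gle s0]) (auto simp: m_def)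
  obtain \<Lambda> where \<Lambda>: "\<And>s t. s \<le> t \<Longrightarrow> t \<le> K + B \<Longrightarrow> G t - G s \<le> \<Lambda> * (t - s)"
    using G_lip[of "K + B"] by blast
  define lam where "lam = max 1 \<Lambda>"
  have lam: "0 < lam" "\<Lambda> \<le> lam" by (auto simp: lam_def)
  define rhs where "rhs f x = lam * f x + \<kappa>\<^sub>0 - G (f x + b x)" for f :: "real^3 \<Rightarrow> real" and x
  define step where "step f = resolvent lam (rhs f)" for f
  define adm where "adm f \<longleftrightarrow> per f \<and> f \<in> borel_measurable borel \<and> (\<forall>x. m \<le> f x \<and> f x \<le> K)"
    for f :: "real^3 \<Rightarrow> real"
  have admD: "per f" "f \<in> borel_measurable borel" "m \<le> f x" "f x \<le> K" if "adm f" for f x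
    using that by (auto simp: adm_def)
  have rhs_mono: "rhs f x \<le> rhs g x" if "f x \<le> g x" "g x \<le> K" for f g x
  proof -
    have "G (g x + b x) - G (f x + b x) \<le> \<Lambda> * ((g x + b x) - (f x + b x))"
      using that bB[of x] by (intro \<Lambda>) auto
    also have "\<dots> \<le> lam * (g x - f x)"
      using that lam by (simp add: mult_right_mono)
    finally show ?thesis by (simp add: rhs_def algebra_simps)
  qed
  have rhs_K: "rhs f x \<le> lam * K" if "adm f" for f x
    using rhs_mono[of f x "\<lambda>_. K"] GK[of x] admD(4)[OF that, of x] by (simp add: rhs_def)
  have rhs_m: "lam * m \<le> rhs f x" if "adm f" for f x
    using rhs_mono[of "\<lambda>_. m" x f] Gm[of x] admD(3,4)[OF that, of x] by (simp add: rhs_def)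
  have rhs_borel [measurable]: "rhs f \<in> borel_measurable borel" if "adm f" for f
    using admD(2)[OF that] unfolding rhs_def by measurable
  define Q where "Q = lam * \<bar>m\<bar> + lam * \<bar>K\<bar>"
  have rhs_Q: "\<bar>rhs f x\<bar> \<le> Q" if "adm f" for f x
  proof -
    have "lam * K \<le> lam * \<bar>K\<bar>" "lam * - \<bar>m\<bar> \<le> lam * m" using lam by (intro mult_left_mono; simp)+
    moreover have "0 \<le> lam * \<bar>m\<bar>" "0 \<le> lam * \<bar>K\<bar>" using lam by simp_all
    ultimately show ?thesis using rhs_K[OF that, of x] rhs_m[OF that, of x] by (simp add: Q_def abs_le_iff)
  qed
  have rhs_L1: "L1_per L (rhs f)" if "adm f" for f
    using admD(1)[OF that] per_b rhs_borel[OF that] rhs_Q[OF that]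
    by (intro L1_per_bounded[where B = Q]) (auto simp: per_def rhs_def)
  have step_adm: "adm (step f)" if f: "adm f" for f
  proof -
    have "step f x \<le> resolvent lam (\<lambda>_. lam * K) x" for x
      unfolding step_def by (rule resolvent_mono[OF lam(1) rhs_borel[OF f] rhs_Q[OF f] _ order_refl rhs_K[OF f]]) simp
    moreover have "resolvent lam (\<lambda>_. lam * m) x \<le> step f x" for x
      unfolding step_def by (rule resolvent_mono[OF lam(1) _ order_refl rhs_borel[OF f] rhs_Q[OF f] rhs_m[OF f]]) simp
    ultimately show ?thesis
      using L1_perD(1,2)[OF resolvent_L1[OF lam(1) rhs_L1[OF f]]] lam
      by (simp add: adm_def step_def resolvent_const)
  qed
  have step_mono: "step f x \<le> step g x" if f: "adm f" and g: "adm g" and le: "\<And>x. f x \<le> g x" for f g x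
    unfolding step_def
    by (rule resolvent_mono[OF lam(1) rhs_borel[OF f] rhs_Q[OF f] rhs_borel[OF g] rhs_Q[OF g]])
       (rule rhs_mono[OF le admD(4)[OF g]])
  define V where "V n = (step ^^ n) (\<lambda>_. K)" for n
  have V_adm: "adm (V n)" for n
  proof (induction n)
    case 0
    then show ?case using mK by (simp add: V_def adm_def per_def)
  next
    case (Suc n)
    then show ?case using step_adm by (simp add: V_def)
  qed
  have V_dec: "V (Suc n) x \<le> V n x" for n x
  proof (induction n arbitrary: x)
    case 0
    then show ?case using admD(4)[OF V_adm[of 1]] by (simp add: V_def)
  next
    case (Suc n)
    then show ?case using step_mono[OF V_adm V_adm Suc] by (simp add: V_def)
  qed
  define v where "v x = lim (\<lambda>n. V n x)" for x
  have V_lim: "(\<lambda>n. V n x) \<longlonglongrightarrow> v x" for x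
  proof -
    have dec: "decseq (\<lambda>n. V n x)" using V_dec by (rule decseq_SucI)
    have "\<forall>i. m \<le> V i x" using admD(3)[OF V_adm] by blast
    then obtain l where l: "(\<lambda>n. V n x) \<longlonglongrightarrow> l"
      by (rule decseq_convergent[OF dec])
    then show ?thesis unfolding v_def limI[OF l] .
  qed
  have v: "adm v"
    unfolding adm_def
  proof (intro conjI allI)
    show "per v"
      using admD(1)[OF V_adm] by (simp add: per_def v_def)
    show "v \<in> borel_measurable borel"
      using V_lim admD(2)[OF V_adm] by (rule borel_measurable_LIMSEQ_real)
    show "m \<le> v x" "v x \<le> K" for x
      using V_lim[of x] admD(3,4)[OF V_adm] by (auto intro: LIMSEQ_le_const LIMSEQ_le_const2)
  qed
  have fixed: "v x = step v x" for x
  proof (rule LIMSEQ_unique)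
    show "(\<lambda>n. V (Suc n) x) \<longlonglongrightarrow> v x" by (rule LIMSEQ_Suc[OF V_lim])
    have "(\<lambda>n. rhs (V n) y) \<longlonglongrightarrow> rhs v y" for y
      unfolding rhs_def by (intro tendsto_intros isCont_tendsto_compose[OF G_cont] V_lim)
    then have "(\<lambda>n. step (V n) x) \<longlonglongrightarrow> step v x"
      unfolding step_def by (rule resolvent_tendsto[OF lam(1) rhs_borel[OF V_adm] rhs_borel[OF v] rhs_Q[OF V_adm]])
    then show "(\<lambda>n. V (Suc n) x) \<longlonglongrightarrow> step v x" by (simp add: V_def)
  qed
  have vC: "\<bar>v x\<bar> \<le> \<bar>m\<bar> + \<bar>K\<bar>" for x
    using admD(3,4)[OF v, of x] by linarith
  have vL: "L1_per L v" by (rule L1_per_bounded[OF admD(1,2)[OF v] vC])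
  have "weak_laplacian L v (\<lambda>x. lam * v x - rhs v x)"
  proof (rule weak_laplacianI_fourier[OF vL])
    show "L1_per L (\<lambda>x. lam * v x - rhs v x)" by (intro L1_per_diff L1_per_cmult vL rhs_L1 v)
    fix k
    let ?s = "(norm (frequency L k))\<^sup>2"
    have ne: "complex_of_real (lam + ?s) \<noteq> 0"
      using lam by (metis add_pos_nonneg less_irrefl of_real_eq_0_iff zero_le_power2)
    have "fc v k = fc (rhs v) k / of_real (lam + ?s)"
    proof -
      have "v = resolvent lam (rhs v)" using fixed by (auto simp: step_def)
      then show ?thesis using fc_resolvent[OF lam(1) rhs_L1[OF v], of k] by metis
    qed
    then have "fc (rhs v) k = of_real (lam + ?s) * fc v k"
      using ne by (metis nonzero_mult_div_cancel_left times_divide_eq_right mult.commute)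
    then show "fc (\<lambda>x. lam * v x - rhs v x) k = - of_real ?s * fc v k"
      using L1_perD(3)[OF L1_per_cmult[OF vL]] L1_perD(3)[OF rhs_L1[OF v]]
      by (simp add: fc_diff fc_cmult algebra_simps)
  qed
  moreover have "lam * v x - rhs v x = G (v x + b x) - \<kappa>\<^sub>0" for x
    by (simp add: rhs_def)
  ultimately show ?thesis
    using that[OF admD(1,2)[OF v] vC] by simp
qed

section \<open>Existence of a solution\<close>

text \<open>The right-hand side that contains \<open>u\<close> itself differs on a null set from the one with bounded
  coefficients for which the equation is solved.\<close>

lemma weak_laplacian_cong_AE:
  assumes w: "weak_laplacian L f g" and g': "per g'" "g' \<in> borel_measurable borel" and eq: "AE x in tor. g x = g' x"
  shows "weak_laplacian L f g'"
proof (rule weak_laplacianI_fourier)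
  have g: "L1_per L g" using w by (simp add: weak_laplacian_def)
  have [measurable]: "g \<in> borel_measurable borel" "g' \<in> borel_measurable borel"
    using L1_perD(2)[OF g] g'(2) by auto
  show "L1_per L f" using w by (simp add: weak_laplacian_def)
  show "L1_per L g'"
    using g' L1_perD(3)[OF g] integrable_cong_AE[of g tor g'] eq by (auto intro!: L1_perI)
  have "fc g' k = fc g k" for k
    unfolding fc_def using eq by (intro integral_cong_AE) (auto elim!: eventually_mono)
  then show "fc g' k = - of_real ((norm (frequency L k))\<^sup>2) * fc f k" for k
    by (simp add: weak_laplacian_fourier[OF w])
qed

lemma weak_laplacian_add:
  assumes w: "weak_laplacian L f g" and w': "weak_laplacian L f' g'"
  shows "weak_laplacian L (\<lambda>x. f x + f' x) (\<lambda>x. g x + g' x)"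
proof (rule weak_laplacianI_fourier)
  have *: "L1_per L f" "L1_per L g" "L1_per L f'" "L1_per L g'"
    using w w' by (auto simp: weak_laplacian_def)
  then show "L1_per L (\<lambda>x. f x + f' x)" "L1_per L (\<lambda>x. g x + g' x)" by (auto intro: L1_per_add)
  show "fc (\<lambda>x. g x + g' x) k = - of_real ((norm (frequency L k))\<^sup>2) * fc (\<lambda>x. f x + f' x) k" for k
    using *[THEN L1_perD(3)]
    by (simp add: fc_add weak_laplacian_fourier[OF w] weak_laplacian_fourier[OF w'] distrib_left)
qed

lemma integrable_square_add:
  fixes f g :: "real^3 \<Rightarrow> real"
  assumes [measurable]: "f \<in> borel_measurable borel" "g \<in> borel_measurable borel"
    and f2: "integrable tor (\<lambda>x. (f x)\<^sup>2)" and g2: "integrable tor (\<lambda>x. (g x)\<^sup>2)"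
  shows "integrable tor (\<lambda>x. (f x + g x)\<^sup>2)"
proof (rule Bochner_Integration.integrable_bound)
  show "integrable tor (\<lambda>x. 2 * (f x)\<^sup>2 + 2 * (g x)\<^sup>2)" using f2 g2 by simp
  have "(f x + g x)\<^sup>2 \<le> 2 * (f x)\<^sup>2 + 2 * (g x)\<^sup>2" for x
    using zero_le_power2[of "f x - g x"] by (simp add: power2_eq_square algebra_simps)
  then show "AE x in tor. norm ((f x + g x)\<^sup>2) \<le> norm (2 * (f x)\<^sup>2 + 2 * (g x)\<^sup>2)" by simp
qed measurable

lemma integrable_square_bounded:
  fixes f :: "real^3 \<Rightarrow> real"
  assumes [measurable]: "f \<in> borel_measurable borel" and B: "\<And>x. \<bar>f x\<bar> \<le> B"
  shows "integrable tor (\<lambda>x. (f x)\<^sup>2)"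
proof (rule integrable_tor_bounded[where B = "B\<^sup>2"])
  show "norm ((f x)\<^sup>2) \<le> B\<^sup>2" for x
    using power_mono[OF B[of x] abs_ge_zero, of 2] by simp
qed measurable

lemma exists_LSC_solution:
  assumes eps: "0 < \<epsilon>" and beta: "0 < \<beta>" and a1: "0 < a\<^sub>1"
    and u: "L1_per L u" and u_low: "AE x in tor. 1 / a\<^sub>1 \<le> u x"
    and \<kappa>: "L2_per L \<kappa>" and \<kappa>0: "0 < mean L \<kappa>"
  shows "\<exists>\<phi>. in_sobolev L 2 \<phi> \<and> LSC_solution L \<epsilon> \<beta> Vcut u \<kappa> \<phi> 0"
proof -
  let ?G = "fermi_density \<epsilon> \<beta>" and ?k = "mean L \<kappa>"
  have \<kappa>L: "L1_per L \<kappa>" using \<kappa> by (simp add: L2_per_def)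
  have \<kappa>_borel [measurable]: "\<kappa> \<in> borel_measurable borel" and u_borel [measurable]: "u \<in> borel_measurable borel"
    by (rule L1_perD(2)[OF \<kappa>L] L1_perD(2)[OF u])+
  have \<kappa>2: "integrable tor (\<lambda>x. (\<kappa> x)\<^sup>2)"
    using \<kappa> by (subst integrable_tor) (auto simp: L2_per_def)
  have [measurable]: "?G \<in> borel_measurable borel"
    using fermi_density_mono[OF eps beta] by (rule borel_measurable_mono)
  \<comment> \<open>Splitting off \<open>\<psi>\<close> reduces the right-hand side \<open>\<kappa>\<close> to its mean.\<close>
  obtain \<psi> B where \<psi>: "per \<psi>" "\<psi> \<in> borel_measurable borel" "\<And>x. \<bar>\<psi> x\<bar> \<le> B"
    and w\<psi>: "weak_laplacian L \<psi> (\<lambda>x. - (\<kappa> x - ?k))"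
  proof (rule Poisson_bounded[of "\<lambda>x. \<kappa> x - ?k"])
    show "L1_per L (\<lambda>x. \<kappa> x - ?k)" by (intro L1_per_diff \<kappa>L L1_per_const)
    have "integrable tor (\<lambda>x. (\<kappa> x + - ?k)\<^sup>2)" by (intro integrable_square_add \<kappa>2) auto
    then show "integrable tor (\<lambda>x. (\<kappa> x - ?k)\<^sup>2)" by simp
    show "(\<integral>x. \<kappa> x - ?k \<partial>tor) = 0"
      using L1_perD(3)[OF \<kappa>L] tor.prob_space by (simp add: mean_tor)
  qed blast
  note [measurable] = \<psi>(2)
  \<comment> \<open>A version of \<open>1 / u\<close> that is bounded everywhere.\<close>
  define w where "w x = 1 / max (u x) (1 / a\<^sub>1)" for x
  have w_bound: "\<bar>w x\<bar> \<le> a\<^sub>1" for x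
  proof -
    have "0 < 1 / a\<^sub>1" using a1 by simp
    moreover have "1 / a\<^sub>1 \<le> max (u x) (1 / a\<^sub>1)" by (rule max.cobounded2)
    ultimately have "0 \<le> w x" "w x \<le> 1 / (1 / a\<^sub>1)"
      unfolding w_def by (simp_all only: zero_le_divide_1_iff frac_le[OF zero_le_one order_refl])
    then show ?thesis by simp
  qed
  have w_eq: "AE x in tor. w x = 1 / u x"
    using u_low by eventually_elim (simp add: w_def max_absorb1)
  have [measurable]: "w \<in> borel_measurable borel" unfolding w_def by measurable
  have per_w: "per w" using L1_perD(1)[OF u] by (simp add: per_def w_def)
  define b where "b x = \<psi> x - w x - Vcut" for x
  have b_borel [measurable]: "b \<in> borel_measurable borel" unfolding b_def by measurable
  have per_b: "per b" using \<psi>(1) per_w by (simp add: per_def b_def)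
  have b_bound: "\<bar>b x\<bar> \<le> B + a\<^sub>1 + \<bar>Vcut\<bar>" for x
    using \<psi>(3)[of x] w_bound[of x] unfolding b_def by linarith
  obtain s0 s1 where s: "?G s0 \<le> ?k" "?k \<le> ?G s1"
    using fermi_density_small[OF eps beta \<kappa>0] fermi_density_large[OF eps beta] by metis
  obtain v C where v: "per v" "v \<in> borel_measurable borel" "\<And>x. \<bar>v x\<bar> \<le> C"
    and wv: "weak_laplacian L v (\<lambda>x. ?G (v x + b x) - ?k)"
    using monotone_iteration[OF per_b b_borel b_bound fermi_density_mono[OF eps beta]
        fermi_density_continuous[OF eps beta] fermi_density_lipschitz[OF eps beta] s] by blast
  note [measurable] = v(2)
  define \<phi> where "\<phi> x = v x + \<psi> x" for x
  define D where "D x = ?G (v x + b x) - \<kappa> x" for x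
  have wD: "weak_laplacian L \<phi> D"
    using weak_laplacian_add[OF wv w\<psi>] by (simp add: \<phi>_def[abs_def] D_def[abs_def])
  have \<phi>_borel [measurable]: "\<phi> \<in> borel_measurable borel" unfolding \<phi>_def by measurable
  have per_\<phi>: "per \<phi>" using v(1) \<psi>(1) by (simp add: per_def \<phi>_def)
  have "in_sobolev L 2 \<phi>"
  proof (rule weak_laplacian_sobolev[OF wD])
    have "\<bar>\<phi> x\<bar> \<le> C + B" for x using v(3)[of x] \<psi>(3)[of x] unfolding \<phi>_def by linarith
    then show "integrable tor (\<lambda>x. (\<phi> x)\<^sup>2)" by (intro integrable_square_bounded) auto
    let ?S = "C + (B + a\<^sub>1 + \<bar>Vcut\<bar>)"
    have "\<bar>?G (v x + b x)\<bar> \<le> \<bar>?G (- ?S)\<bar> + \<bar>?G ?S\<bar>" for x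
    proof -
      have "- ?S \<le> v x + b x" "v x + b x \<le> ?S" using v(3)[of x] b_bound[of x] by linarith+
      from this[THEN monoD[OF fermi_density_mono[OF eps beta]]] show ?thesis by linarith
    qed
    then have "integrable tor (\<lambda>x. (?G (v x + b x))\<^sup>2)" by (intro integrable_square_bounded) auto
    moreover have "integrable tor (\<lambda>x. (- \<kappa> x)\<^sup>2)" using \<kappa>2 by simp
    ultimately have "integrable tor (\<lambda>x. (?G (v x + b x) + - \<kappa> x)\<^sup>2)"
      by (intro integrable_square_add) auto
    then show "integrable tor (\<lambda>x. (D x)\<^sup>2)" by (simp add: D_def)
  qed
  moreover have "LSC_solution L \<epsilon> \<beta> Vcut u \<kappa> \<phi> 0"
  proof -
    define D' where "D' x = ?G (\<phi> x - 1 / u x - Vcut) - \<kappa> x" for x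
    have "weak_laplacian L \<phi> D'"
    proof (rule weak_laplacian_cong_AE[OF wD])
      show "per D'"
        using per_\<phi> L1_perD(1)[OF u] L1_perD(1)[OF \<kappa>L] by (simp add: per_def D'_def)
      show "D' \<in> borel_measurable borel" unfolding D'_def by measurable
      show "AE x in tor. D x = D' x"
        using w_eq by eventually_elim (simp add: D_def D'_def b_def \<phi>_def add_diff_eq)
    qed
    moreover have "- D' x = \<kappa> x - F_LSC \<epsilon> \<beta> Vcut u \<phi> 0 x" for x
      by (simp add: F_LSC_eq D'_def)
    ultimately show ?thesis unfolding LSC_solution_def by blast
  qed
  ultimately show ?thesis by blast
qed

end

theorem theorem1p7:
  fixes L :: int
    and \<epsilon> \<beta> Vcut c C \<delta> \<kappa>\<^sub>0 :: real
    and \<omega> :: "int^3 \<Rightarrow> real"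
    and u\<^sub>2 \<kappa> :: "real^3 \<Rightarrow> real"
  assumes "0 < L" and "0 < \<epsilon>" and "0 < \<beta>"
    and "landscape_admissible L \<omega>"
    and "\<delta> = Vmax \<omega> - Vmin \<omega>" and "0 < \<delta>"
    and "0 < c" and "0 < C"
    and "c * \<delta> powr (1/4) \<le> Vmin \<omega> - Vcut"
    and "Vmin \<omega> - Vcut \<le> C * \<delta> powr (1/4)"
    and "landscape_function L \<epsilon> (potential \<omega>) Vcut u\<^sub>2"
    and "\<kappa>\<^sub>0 = mean L \<kappa>"
    and "in_sobolev L (-2) (\<lambda>x. \<kappa> x - \<kappa>\<^sub>0)"
    and "0 < \<kappa>\<^sub>0" and "L2_per L \<kappa>"
  shows "\<exists>(\<phi> :: real^3 \<Rightarrow> real) (\<mu> :: real).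
           in_sobolev L 2 \<phi> \<and> LSC_solution L \<epsilon> \<beta> Vcut u\<^sub>2 \<kappa> \<phi> \<mu>"
proof -
  interpret torus L by unfold_locales fact
  define a\<^sub>0 where "a\<^sub>0 = Vmin \<omega> - Vcut"
  define a\<^sub>1 where "a\<^sub>1 = Vmax \<omega> - Vcut"
  have "0 < c * \<delta> powr (1/4)" using assms(6,7) by simp
  then have a0: "0 < a\<^sub>0" using assms(9) by (simp add: a\<^sub>0_def)
  have a1: "0 < a\<^sub>1" using a0 assms(5,6) by (simp add: a\<^sub>0_def a\<^sub>1_def)
  note pot = potential_bounds[OF assms(1,4)]
  have "AE x in tor. 1 / a\<^sub>1 \<le> u\<^sub>2 x"
    by (rule landscape_lower_bound[OF assms(2) a0 _ _ assms(11)]) (use pot in \<open>auto simp: a\<^sub>0_def a\<^sub>1_def\<close>)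
  moreover have "L1_per L u\<^sub>2"
    using assms(11) by (simp add: landscape_function_def in_sobolev_def)
  ultimately show ?thesis
    using exists_LSC_solution[OF assms(2,3) a1] assms(12,14,15) by blast
qed

end
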